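(* Let $\mathbb F\in\{\mathbb R,\mathbb C\}$ and let $T:\mathcal T_n\to\mathcal T_n$ be an $\mathbb F$-linear map on the space $\mathcal T_n$ of $n\times n$ Toeplitz matrices over $\mathbb F$. Then $\det(T(A))=\det(A)$ for all $A\in\mathcal T_n$ if and only if there are nonzero $\gamma,r\in\mathbb F$ such that $T$ has the form $A\mapsto MAN$ with $M=\gamma F_nN^\top F_n$, with $N$ of one of the forms (1) $N=V_n(\alpha)D_n(r)$ for some $\alpha\in\mathbb F$, (2) $N=V_n(\alpha)F_nD_n(r)$ for some $\alpha\in\mathbb F$, (3) $N=W_n(\alpha,\beta)D_n(r)$ for some $\alpha,\beta\in\mathbb F$ with $\alpha\neq\beta$, and $\det(MN)=1$; equivalently, $\gamma^nr^{n(n-1)}=1$ and, in case (3), also $(\alpha-\beta)^{n(n-1)}=1$.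
   Context: A matrix $A\in M_n(\mathbb F)$ is Toeplitz if $A=[a_{i-j}]_{i,j=1}^n$ for some $a_{1-n},\dots,a_{n-1}\in\mathbb F$. $\mathbf e_1$ is the first column of $I_n$; $Z_n$ is the $n\times n$ lower shift matrix (ones on the first subdiagonal, zeros elsewhere); $\mathcal J_\alpha=\alpha I_n+Z_n$. $F_n$ is the $n\times n$ anti-diagonal permutation matrix (ones on the anti-diagonal, zeros elsewhere). $D_n(r)=\mathrm{diag}(1,r,\dots,r^{n-1})$. $V_n(\alpha)=[\mathbf e_1\ \mathcal J_\alpha\mathbf e_1\ \cdots\ \mathcal J_\alpha^{n-1}\mathbf e_1]$, i.e. the upper triangular matrix with $(i,j)$ entry $\binom{j-1}{i-1}\alpha^{j-i}$ for $i\le j$ (with $0^0=1$). $W_n(\alpha,\beta)$ is the $n\times n$ matrix whose $j$-th column is $\mathcal J_\beta^{n-j}\mathcal J_\alpha^{j-1}\mathbf e_1$, $j=1,\dots,n$.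
   Formalization: In case (3), det(MN)=1 is equivalent to the single condition γ^n r^{n(n-1)} (α-β)^{n(n-1)} = 1, not to the two separate equations stated (n=2, α=2, β=0, r=1, γ=1/2 is a counterexample). *)

theory Defs
  imports Complex_Main "Jordan_Normal_Form.Determinant"
begin

(* Rows and columns of n x n matrices are indexed from 0 to n - 1, so every index is one less
   than in the usual convention. *)

definition toeplitz_mats :: "nat \<Rightarrow> 'a mat set" where
  "toeplitz_mats n = {A. \<exists>a :: int \<Rightarrow> 'a. A = mat n n (\<lambda>(i, j). a (int i - int j))}"

(* T is a linear map from the space of Toeplitz matrices to itself; its values on other matrices
   are irrelevant. *)
definition toeplitz_linear :: "nat \<Rightarrow> ('a :: field mat \<Rightarrow> 'a mat) \<Rightarrow> bool" where
  "toeplitz_linear n T \<longleftrightarrow>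
     (\<forall>A \<in> toeplitz_mats n. T A \<in> toeplitz_mats n) \<and>
     (\<forall>A \<in> toeplitz_mats n. \<forall>B \<in> toeplitz_mats n. T (A + B) = T A + T B) \<and>
     (\<forall>c. \<forall>A \<in> toeplitz_mats n. T (c \<cdot>\<^sub>m A) = c \<cdot>\<^sub>m T A)"

definition shift_mat :: "nat \<Rightarrow> 'a :: field mat" where
  "shift_mat n = mat n n (\<lambda>(i, j). if i = j + 1 then 1 else 0)"

definition J_mat :: "nat \<Rightarrow> 'a :: field \<Rightarrow> 'a mat" where
  "J_mat n \<alpha> = \<alpha> \<cdot>\<^sub>m 1\<^sub>m n + shift_mat n"

definition F_mat :: "nat \<Rightarrow> 'a :: field mat" where
  "F_mat n = mat n n (\<lambda>(i, j). if i + j + 1 = n then 1 else 0)"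

definition D_mat :: "nat \<Rightarrow> 'a :: field \<Rightarrow> 'a mat" where
  "D_mat n r = mat_diag n (\<lambda>i. r ^ i)"

definition V_mat :: "nat \<Rightarrow> 'a :: field \<Rightarrow> 'a mat" where
  "V_mat n \<alpha> = mat_of_cols n (map (\<lambda>j. (J_mat n \<alpha> ^\<^sub>m j) *\<^sub>v unit_vec n 0) [0..<n])"

definition W_mat :: "nat \<Rightarrow> 'a :: field \<Rightarrow> 'a \<Rightarrow> 'a mat" where
  "W_mat n \<alpha> \<beta> =
     mat_of_cols n
       (map (\<lambda>j. (J_mat n \<beta> ^\<^sub>m (n - 1 - j) * J_mat n \<alpha> ^\<^sub>m j) *\<^sub>v unit_vec n 0) [0..<n])"

definition left_factor :: "nat \<Rightarrow> 'a :: field \<Rightarrow> 'a mat \<Rightarrow> 'a mat" where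
  "left_factor n \<gamma> N = \<gamma> \<cdot>\<^sub>m (F_mat n * transpose_mat N * F_mat n)"

end

theory Submission
  imports Defs "HOL-Computational_Algebra.Field_as_Ring"
begin

text \<open>Reversing the rows turns a Toeplitz matrix into a Hankel matrix \<open>H(h)\<close>, that is, into a linear functional
  \<open>L\<close> on polynomials of degree at most \<open>2n - 2\<close> with \<open>L(x\<^sup>k) = h\<^sub>k\<close>, and \<open>N\<^sup>T H(h) N\<close> has the entries
  \<open>L(p\<^sub>i p\<^sub>j)\<close> when the columns of \<open>N\<close> are the coefficients of the \<open>p\<^sub>j\<close>. The three forms of
  \<open>N\<close> are, up to a scalar factor, exactly those with \<open>p\<^sub>j = A\<^bsup>n-1-j\<^esup> B\<^sup>j\<close> for independent linear forms \<open>A, B\<close>.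

  A linear map preserving the determinant preserves the directions along which the determinant is an
  affine function. These are the Hankel matrices of rank at most one: a \<open>2 \<times> 2\<close> minor of every
  translate of \<open>h\<close> vanishes, so the Hessian of the binary form attached to \<open>h\<close> is zero and
  the form is a power of a linear form. Hence the image of \<open>(x\<^sup>k)\<^sub>k\<close> is, for every \<open>x\<close>, a
  geometric progression whose entries are polynomials in \<open>x\<close> of degree at most \<open>2n - 2\<close>, and unique
  factorization shows that these are \<open>c A\<^bsup>2n-2-k\<^esup> B\<^sup>k\<close>.\<close>

section \<open>Hankel matrices as moment functionals\<close>

text \<open>Cutting the sum at \<open>degree p\<close> makes the functional total on polynomials,
  for an infinite sequence \<open>h\<close>; \<open>mom_bound\<close> then allows any larger cut, so
  that different polynomials can share one range.\<close>

definition mom :: "(nat \<Rightarrow> 'a) \<Rightarrow> 'a :: comm_ring_1 poly \<Rightarrow> 'a" where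
  "mom h p = (\<Sum>i\<le>degree p. coeff p i * h i)"

lemma mom_bound:
  assumes "degree p \<le> d"
  shows "mom h p = (\<Sum>i\<le>d. coeff p i * h i)"
  unfolding mom_def using assms
  by (intro sum.mono_neutral_left) (auto simp: coeff_eq_0)

lemma mom_add: "mom h (p + q) = mom h p + mom h q"
proof -
  define d where "d = max (degree p) (degree q)"
  have "degree (p + q) \<le> d" "degree p \<le> d" "degree q \<le> d"
    unfolding d_def by (auto intro: degree_add_le)
  then show ?thesis
    by (simp add: mom_bound[where d = d] algebra_simps sum.distrib)
qed

lemma mom_smult: "mom h (smult c p) = c * mom h p"
  by (subst mom_bound[where d = "degree p"])
    (auto simp: mom_def sum_distrib_left mult.assoc degree_smult_le)

lemma mom_0 [simp]: "mom h 0 = 0"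
  by (simp add: mom_def)

lemma mom_monom: "mom h (monom c k) = c * h k"
  by (subst mom_bound[where d = k]) (auto simp: degree_monom_le coeff_monom if_distrib[of "\<lambda>x. x * _"] cong: if_cong)

lemma mom_sum: "mom h (sum f S) = (\<Sum>x\<in>S. mom h (f x))"
  by (induction S rule: infinite_finite_induct) (auto simp: mom_add)

lemma mom_mult:
  assumes "degree p < m" "degree q < n"
  shows "mom h (p * q) = (\<Sum>i<m. \<Sum>j<n. coeff p i * coeff q j * h (i + j))"
proof -
  have expand: "r = (\<Sum>i<k. monom (coeff r i) i)" if "degree r < k" for r :: "'a poly" and k
  proof (rule poly_eqI)
    fix i
    show "coeff r i = coeff (\<Sum>i<k. monom (coeff r i) i) i"
      using that by (auto simp: coeff_sum coeff_monom coeff_eq_0)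
  qed
  have "p * q = (\<Sum>i<m. \<Sum>j<n. monom (coeff p i * coeff q j) (i + j))"
    by (subst expand[OF assms(1)], subst expand[OF assms(2)]) (simp add: sum_product mult_monom)
  then show ?thesis
    by (simp add: mom_sum mom_monom)
qed

lemma mom_cong:
  assumes "\<And>i. i \<le> degree p \<Longrightarrow> g i = h i"
  shows "mom g p = mom h p"
  using assms by (simp add: mom_def)

lemma mom_lincomb: "mom (\<lambda>k. a * g k + b * h k) p = a * mom g p + b * mom h p"
  by (simp add: mom_def sum.distrib sum_distrib_left algebra_simps)

text \<open>Geometric sequences are multiples of point evaluations: the node is \<open>x\<close>,
  the weight \<open>c\<close>.\<close>

lemma mom_power: "mom (\<lambda>k. c * x ^ k) p = c * poly p x"
  by (simp add: mom_def poly_altdef sum_distrib_left algebra_simps)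

definition hankel :: "nat \<Rightarrow> (nat \<Rightarrow> 'a) \<Rightarrow> 'a mat" where
  "hankel n h = mat n n (\<lambda>(i, j). h (i + j))"

lemma hankel_carrier [simp]: "hankel n h \<in> carrier_mat n n"
  by (simp add: hankel_def)

lemma hankel_cong:
  assumes "\<And>k. k \<le> 2 * n - 2 \<Longrightarrow> g k = h k"
  shows "hankel n g = hankel n h"
  by (rule eq_matI) (auto simp: hankel_def intro!: assms)

definition poly_cols :: "nat \<Rightarrow> (nat \<Rightarrow> 'a poly) \<Rightarrow> 'a :: comm_ring_1 mat" where
  "poly_cols n p = mat n n (\<lambda>(i, j). coeff (p j) i)"

lemma poly_cols_carrier [simp]: "poly_cols n p \<in> carrier_mat n n"
  by (simp add: poly_cols_def)

text \<open>Change of basis for the bilinear form sending \<open>p\<close>, \<open>q\<close> to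
  \<open>mom h (p * q)\<close>. The degree bound ensures that column \<open>j\<close> holds the
  whole polynomial \<open>p j\<close>, not a truncation.\<close>

lemma hankel_congruence:
  assumes "\<And>j. j < n \<Longrightarrow> degree (p j) < n"
  shows "transpose_mat (poly_cols n p) * hankel n h * poly_cols n p =
    mat n n (\<lambda>(i, j). mom h (p i * p j))"
proof (rule eq_matI)
  fix i j assume "i < dim_row (mat n n (\<lambda>(i, j). mom h (p i * p j)))"
    "j < dim_col (mat n n (\<lambda>(i, j). mom h (p i * p j)))"
  then have ij: "i < n" "j < n" by auto
  have "(transpose_mat (poly_cols n p) * hankel n h * poly_cols n p) $$ (i, j) =
      (\<Sum>l = 0..<n. (\<Sum>k = 0..<n. coeff (p i) k * h (k + l)) * coeff (p j) l)"
    using ij by (simp add: poly_cols_def hankel_def scalar_prod_def)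
  also have "\<dots> = (\<Sum>l<n. \<Sum>k<n. coeff (p i) k * coeff (p j) l * h (k + l))"
    by (simp add: sum_distrib_right sum_distrib_left atLeast0LessThan mult_ac)
  also have "\<dots> = (\<Sum>k<n. \<Sum>l<n. coeff (p i) k * coeff (p j) l * h (k + l))"
    by (rule sum.swap)
  also have "\<dots> = mom h (p i * p j)"
    using assms ij by (simp add: mom_mult[where m = n and n = n])
  finally show "(transpose_mat (poly_cols n p) * hankel n h * poly_cols n p) $$ (i, j) =
      mat n n (\<lambda>(i, j). mom h (p i * p j)) $$ (i, j)"
    using ij by simp
qed (auto simp: poly_cols_def)

section \<open>The matrices of the canonical forms\<close>

lemma J_mat_carrier [simp]: "J_mat n \<alpha> \<in> carrier_mat n n"
  by (simp add: J_mat_def shift_mat_def)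

text \<open>The shift matrix truncates products with \<^term>\<open>[:\<alpha>, 1:]\<close> to their coefficients below \<^term>\<open>n\<close>,
  so no degree bound is needed.\<close>

lemma J_mat_mult_coeff:
  "J_mat n \<alpha> *\<^sub>v vec n (coeff q) = vec n (coeff ([:\<alpha>, 1:] * q))"
proof (rule eq_vecI)
  fix i assume "i < dim_vec (vec n (coeff ([:\<alpha>, 1:] * q)))"
  then have i: "i < n" by simp
  have "(J_mat n \<alpha> *\<^sub>v vec n (coeff q)) $ i =
     (\<Sum>k = 0..<n. (if i = k then \<alpha> * coeff q k else 0) + (if i = k + 1 then coeff q k else 0))"
    using i by (auto simp: J_mat_def shift_mat_def scalar_prod_def algebra_simps intro!: sum.cong)
  also have "\<dots> = \<alpha> * coeff q i + (\<Sum>k = 0..<n. (if i = k + 1 then coeff q k else 0))"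
    using i by (simp add: sum.distrib)
  also have "(\<Sum>k = 0..<n. (if i = k + 1 then coeff q k else 0)) = coeff (pCons 0 q) i"
    using i by (cases i) auto
  finally show "(J_mat n \<alpha> *\<^sub>v vec n (coeff q)) $ i = vec n (coeff ([:\<alpha>, 1:] * q)) $ i"
    using i by simp
qed (simp add: J_mat_def shift_mat_def)

lemma J_mat_pow_mult_coeff:
  "J_mat n \<alpha> ^\<^sub>m k *\<^sub>v vec n (coeff q) = vec n (coeff ([:\<alpha>, 1:] ^ k * q))"
proof (induction k arbitrary: q)
  case 0
  then show ?case by (simp add: J_mat_def shift_mat_def)
next
  case (Suc k)
  have "J_mat n \<alpha> ^\<^sub>m Suc k *\<^sub>v vec n (coeff q) =
      J_mat n \<alpha> ^\<^sub>m k *\<^sub>v (J_mat n \<alpha> *\<^sub>v vec n (coeff q))"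
    by (simp add: assoc_mult_mat_vec[of _ n n _ n] pow_carrier_mat)
  then show ?case
    by (simp only: J_mat_mult_coeff Suc.IH) (simp only: power_Suc2 mult.assoc)
qed

lemma unit_vec_0_coeff: "unit_vec n 0 = vec n (coeff (1 :: 'a :: comm_ring_1 poly))"
  by (rule eq_vecI) (auto simp: unit_vec_def coeff_1)

text \<open>The first unit vector is the constant polynomial 1, and powers of
  \<open>J_mat n \<alpha>\<close> multiply it by powers of \<open>[:\<alpha>, 1:]\<close>.\<close>

lemma V_mat_poly_cols: "V_mat n \<alpha> = poly_cols n (\<lambda>j. [:\<alpha>, 1:] ^ j)"
  by (rule eq_matI)
    (auto simp: V_mat_def poly_cols_def mat_of_cols_index unit_vec_0_coeff J_mat_pow_mult_coeff)

lemma W_mat_poly_cols: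
  "W_mat n \<alpha> \<beta> = poly_cols n (\<lambda>j. [:\<beta>, 1:] ^ (n - 1 - j) * [:\<alpha>, 1:] ^ j)"
proof (rule eq_matI)
  fix i j assume "i < dim_row (poly_cols n (\<lambda>j. [:\<beta>, 1:] ^ (n - 1 - j) * [:\<alpha>, 1:] ^ j))"
    "j < dim_col (poly_cols n (\<lambda>j. [:\<beta>, 1:] ^ (n - 1 - j) * [:\<alpha>, 1:] ^ j))"
  then have ij: "i < n" "j < n" by (auto simp: poly_cols_def)
  have "(J_mat n \<beta> ^\<^sub>m (n - 1 - j) * J_mat n \<alpha> ^\<^sub>m j) *\<^sub>v vec n (coeff 1) =
      J_mat n \<beta> ^\<^sub>m (n - 1 - j) *\<^sub>v (J_mat n \<alpha> ^\<^sub>m j *\<^sub>v vec n (coeff 1))"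
    by (simp add: assoc_mult_mat_vec[of _ n n _ n] pow_carrier_mat)
  then show "W_mat n \<alpha> \<beta> $$ (i, j) =
      poly_cols n (\<lambda>j. [:\<beta>, 1:] ^ (n - 1 - j) * [:\<alpha>, 1:] ^ j) $$ (i, j)"
    using ij by (simp add: W_mat_def poly_cols_def mat_of_cols_index unit_vec_0_coeff J_mat_pow_mult_coeff)
qed (auto simp: W_mat_def poly_cols_def)

section \<open>Products with F and D, and determinants of the factors\<close>

lemma F_mat_carrier [simp]: "F_mat n \<in> carrier_mat n n"
  by (simp add: F_mat_def)

lemma F_mat_dim [simp]: "dim_row (F_mat n) = n" "dim_col (F_mat n) = n"
  by (simp_all add: F_mat_def)

lemma D_mat_carrier [simp]: "D_mat n r \<in> carrier_mat n n"
  by (simp add: D_mat_def)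

lemma F_mat_mult_left:
  assumes "A \<in> carrier_mat n m"
  shows "F_mat n * A = mat n m (\<lambda>(i, j). A $$ (n - 1 - i, j))"
proof (rule eq_matI)
  fix i j assume "i < dim_row (mat n m (\<lambda>(i, j). A $$ (n - 1 - i, j)))"
    "j < dim_col (mat n m (\<lambda>(i, j). A $$ (n - 1 - i, j)))"
  then have ij: "i < n" "j < m" by auto
  have "(F_mat n * A) $$ (i, j) = (\<Sum>k = 0..<n. (if i + k + 1 = n then 1 else 0) * A $$ (k, j))"
    using ij assms by (simp add: F_mat_def scalar_prod_def)
  also have "\<dots> = (\<Sum>k = 0..<n. if k = n - 1 - i then A $$ (k, j) else 0)"
    using ij by (intro sum.cong) auto
  finally show "(F_mat n * A) $$ (i, j) = mat n m (\<lambda>(i, j). A $$ (n - 1 - i, j)) $$ (i, j)"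
    using ij by simp
qed (use assms in \<open>auto simp: F_mat_def\<close>)

lemma F_mat_mult_right:
  assumes "A \<in> carrier_mat m n"
  shows "A * F_mat n = mat m n (\<lambda>(i, j). A $$ (i, n - 1 - j))"
proof (rule eq_matI)
  fix i j assume "i < dim_row (mat m n (\<lambda>(i, j). A $$ (i, n - 1 - j)))"
    "j < dim_col (mat m n (\<lambda>(i, j). A $$ (i, n - 1 - j)))"
  then have ij: "i < m" "j < n" by auto
  have "(A * F_mat n) $$ (i, j) = (\<Sum>k = 0..<n. A $$ (i, k) * (if k + j + 1 = n then 1 else 0))"
    using ij assms by (simp add: F_mat_def scalar_prod_def)
  also have "\<dots> = (\<Sum>k = 0..<n. if k = n - 1 - j then A $$ (i, k) else 0)"
    using ij by (intro sum.cong) auto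
  finally show "(A * F_mat n) $$ (i, j) = mat m n (\<lambda>(i, j). A $$ (i, n - 1 - j)) $$ (i, j)"
    using ij by simp
qed (use assms in \<open>auto simp: F_mat_def\<close>)

lemma F_mat_square: "F_mat n * F_mat n = 1\<^sub>m n"
  by (subst F_mat_mult_left[where m = n], simp, rule eq_matI) (auto simp: F_mat_def)

text \<open>Squaring avoids the sign of the reversal permutation; \<open>F_mat n\<close> enters
  \<open>left_factor\<close> twice, so the square is what matters there.\<close>

lemma det_F_mat_square: "det (F_mat n) ^ 2 = 1"
  using det_mult[of "F_mat n" n "F_mat n"] by (simp add: F_mat_square power2_eq_square)

lemma det_F_mat_nonzero: "det (F_mat n :: 'a :: field mat) \<noteq> 0"
  using det_F_mat_square[of n, where ?'a = 'a] by auto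

lemma poly_cols_mult_F: "poly_cols n p * F_mat n = poly_cols n (\<lambda>j. p (n - 1 - j))"
  by (subst F_mat_mult_right[where m = n], simp, rule eq_matI) (auto simp: poly_cols_def)

lemma poly_cols_mult_D: "poly_cols n p * D_mat n r = poly_cols n (\<lambda>j. smult (r ^ j) (p j))"
  unfolding D_mat_def
  by (subst mat_diag_mult_right[where nr = n], simp, rule eq_matI) (auto simp: poly_cols_def)

lemma det_poly_cols_triangular:
  assumes "\<And>j. j < n \<Longrightarrow> degree (p j) \<le> j"
  shows "det (poly_cols n p) = (\<Prod>j<n. coeff (p j) j)"
proof -
  have "upper_triangular (poly_cols n p)"
  proof (rule upper_triangularI)
    fix i j assume "j < i" "i < dim_row (poly_cols n p)"
    then have "j < i" "i < n" by (auto simp: poly_cols_def)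
    then show "poly_cols n p $$ (i, j) = 0"
      using assms[of j] by (simp add: poly_cols_def coeff_eq_0)
  qed
  then have "det (poly_cols n p) = prod_list (diag_mat (poly_cols n p))"
    by (rule det_upper_triangular[OF _ poly_cols_carrier])
  then show ?thesis
    by (simp add: prod_list_diag_prod poly_cols_def atLeast0LessThan)
qed

lemma det_V_mat: "det (V_mat n (\<alpha> :: 'a :: field)) = 1"
  unfolding V_mat_poly_cols
  by (subst det_poly_cols_triangular) (auto simp: coeff_linear_power degree_linear_power)

text \<open>The square clears the half in the exponent \<open>n * (n - 1) / 2\<close>.\<close>

lemma prod_powers: "(\<Prod>j<n. r ^ j) ^ 2 = (r :: 'a :: comm_ring_1) ^ (n * (n - 1))"
proof (induction n)
  case (Suc n)
  have "n * 2 + n * (n - 1) = Suc n * (Suc n - 1)"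
    by (cases n) auto
  moreover have "(\<Prod>j<Suc n. r ^ j) ^ 2 = r ^ (n * 2) * r ^ (n * (n - 1))"
    by (simp add: power_mult_distrib Suc power_mult)
  ultimately show ?case
    by (metis power_add)
qed simp

lemma det_D_mat_square: "det (D_mat n r) ^ 2 = (r :: 'a :: field) ^ (n * (n - 1))"
proof -
  have "D_mat n r = poly_cols n (\<lambda>j. monom (r ^ j) j)"
    by (rule eq_matI) (auto simp: D_mat_def mat_diag_def poly_cols_def)
  then have "det (D_mat n r) = (\<Prod>j<n. r ^ j)"
    by (simp add: det_poly_cols_triangular degree_monom_le)
  then show ?thesis by (simp add: prod_powers)
qed

lemma pcompose_power: "pcompose (p ^ k) q = pcompose p q ^ k" for p q :: "'a :: comm_ring_1 poly"
  by (induction k) (simp_all add: pcompose_1 pcompose_mult)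

lemma pcompose_sum_powers:
  "pcompose p q = (\<Sum>k\<le>degree p. smult (coeff p k) (q ^ k))" for p q :: "'a :: comm_ring_1 poly"
  by (subst poly_as_sum_of_monoms[symmetric])
    (simp add: pcompose_sum monom_altdef pcompose_smult pcompose_power pcompose_pCons)

text \<open>Substituting \<open>x + \<beta>\<close> multiplies the coefficient matrix from the left
  by the unipotent matrix \<open>V_mat n \<beta>\<close>.\<close>

lemma det_poly_cols_pcompose:
  fixes p :: "nat \<Rightarrow> 'a :: field poly"
  assumes "\<And>j. j < n \<Longrightarrow> degree (p j) < n"
  shows "det (poly_cols n (\<lambda>j. pcompose (p j) [:\<beta>, 1:])) = det (poly_cols n p)"
proof -
  have "poly_cols n (\<lambda>j. pcompose (p j) [:\<beta>, 1:]) = V_mat n \<beta> * poly_cols n p"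
  proof (rule eq_matI)
    fix i j assume "i < dim_row (V_mat n \<beta> * poly_cols n p)" "j < dim_col (V_mat n \<beta> * poly_cols n p)"
    then have ij: "i < n" "j < n" by (auto simp: V_mat_poly_cols poly_cols_def)
    have "pcompose (p j) [:\<beta>, 1:] = (\<Sum>k\<le>degree (p j). smult (coeff (p j) k) ([:\<beta>, 1:] ^ k))"
      by (rule pcompose_sum_powers)
    also have "\<dots> = (\<Sum>k<n. smult (coeff (p j) k) ([:\<beta>, 1:] ^ k))"
      using assms[OF ij(2)] by (intro sum.mono_neutral_left) (auto simp: coeff_eq_0)
    finally show "poly_cols n (\<lambda>j. pcompose (p j) [:\<beta>, 1:]) $$ (i, j) =
        (V_mat n \<beta> * poly_cols n p) $$ (i, j)"
      using ij by (simp add: V_mat_poly_cols poly_cols_def scalar_prod_def coeff_sum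
          atLeast0LessThan mult.commute)
  qed (auto simp: V_mat_poly_cols poly_cols_def)
  moreover have "V_mat n \<beta> \<in> carrier_mat n n"
    by (simp add: V_mat_poly_cols)
  ultimately show ?thesis
    by (simp add: det_mult[where n = n] det_V_mat)
qed

text \<open>Undoing the substitution \<open>x + \<beta>\<close> turns column \<open>j\<close> into
  \<open>x^(n-1-j) * (x + \<delta>)^j\<close>, whose lowest term is
  \<open>\<delta>^j * x^(n-1-j)\<close>. Reversing the rows therefore gives an upper triangular
  matrix with diagonal entries \<open>\<delta>^j\<close>.\<close>

lemma det_W_mat_square:
  fixes \<alpha> \<beta> :: "'a :: field"
  shows "det (W_mat n \<alpha> \<beta>) ^ 2 = (\<alpha> - \<beta>) ^ (n * (n - 1))"
proof -
  define \<delta> where "\<delta> = \<alpha> - \<beta>"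
  define p where "p j = monom 1 (n - 1 - j) * [:\<delta>, 1:] ^ j" for j
  have deg: "degree (p j) < n" if "j < n" for j
    using that unfolding p_def
    by (intro le_less_trans[OF degree_mult_le]) (auto simp: degree_linear_power degree_monom_eq)
  have shift: "pcompose (p j) [:\<beta>, 1:] = [:\<beta>, 1:] ^ (n - 1 - j) * [:\<alpha>, 1:] ^ j" for j
    by (simp add: p_def pcompose_mult pcompose_power monom_altdef pcompose_smult pcompose_pCons \<delta>_def)
  have coeff_p: "coeff (p j) k = (if n - 1 - j \<le> k then coeff ([:\<delta>, 1:] ^ j) (k - (n - 1 - j)) else 0)"
    for j k
    by (simp add: p_def coeff_monom_mult)
  have "upper_triangular (F_mat n * poly_cols n p)"
    by (rule upper_triangularI) (auto simp: F_mat_mult_left[where m = n] poly_cols_def coeff_p)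
  then have "det (F_mat n * poly_cols n p) = prod_list (diag_mat (F_mat n * poly_cols n p))"
    by (rule det_upper_triangular[OF _ mult_carrier_mat[OF F_mat_carrier poly_cols_carrier]])
  also have "\<dots> = (\<Prod>j<n. \<delta> ^ j)"
    by (simp add: prod_list_diag_prod F_mat_mult_left[where m = n] poly_cols_def coeff_p
        atLeast0LessThan coeff_0_power)
  finally have "det (F_mat n) * det (poly_cols n p) = (\<Prod>j<n. \<delta> ^ j)"
    by (simp add: det_mult[where n = n])
  then have "det (F_mat n :: 'a mat) ^ 2 * det (poly_cols n p) ^ 2 = (\<Prod>j<n. \<delta> ^ j) ^ 2"
    by (metis power_mult_distrib)
  moreover have "det (W_mat n \<alpha> \<beta>) = det (poly_cols n p)"
    unfolding W_mat_poly_cols using det_poly_cols_pcompose[of n p \<beta>] deg by (simp add: shift)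
  ultimately show ?thesis
    by (simp add: det_F_mat_square prod_powers \<delta>_def)
qed

lemma det_left_factor_mult:
  fixes N :: "'a :: field mat"
  assumes "N \<in> carrier_mat n n"
  shows "det (left_factor n \<gamma> N * N) = \<gamma> ^ n * det N ^ 2"
proof -
  have "det (left_factor n \<gamma> N * N) = \<gamma> ^ n * (det (F_mat n) ^ 2 * det N ^ 2)"
    using assms unfolding left_factor_def
    by (subst det_mult[of _ n]) (auto simp: det_mult[where n = n] det_transpose[where n = n]
        power2_eq_square mult_carrier_mat[where n = n])
  then show ?thesis
    by (simp add: det_F_mat_square)
qed

section \<open>Shears\<close>

text \<open>Moments of the functional composed with the substitution \<open>x + \<alpha>\<close>; a
  geometric sequence with node \<open>e\<close> becomes one with node
  \<open>e + \<alpha>\<close>.\<close>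

definition shear :: "'a \<Rightarrow> (nat \<Rightarrow> 'a) \<Rightarrow> nat \<Rightarrow> 'a :: comm_ring_1" where
  "shear \<alpha> h k = mom h ([:\<alpha>, 1:] ^ k)"

lemma mom_shear: "mom (shear \<alpha> h) p = mom h (pcompose p [:\<alpha>, 1:])"
  by (simp add: pcompose_sum_powers mom_sum mom_smult shear_def mom_def[of "shear \<alpha> h"])

lemma shear_lincomb: "shear \<alpha> (\<lambda>k. g k + t * h k) = (\<lambda>k. shear \<alpha> g k + t * shear \<alpha> h k)"
  using mom_lincomb[of 1 g t h] by (auto simp: shear_def)

lemma shear_shear_uminus:
  assumes "\<alpha> + \<beta> = 0"
  shows "shear \<alpha> (shear \<beta> h) = h"
proof
  fix k
  have "shear \<alpha> (shear \<beta> h) k = mom h ([:0, 1:] ^ k)"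
    using assms unfolding shear_def[of \<alpha>]
    by (simp add: mom_shear pcompose_power pcompose_pCons add.commute)
  then show "shear \<alpha> (shear \<beta> h) k = h k"
    using mom_monom[of h 1 k] by (simp add: monom_altdef)
qed

text \<open>A shear is the congruence by \<open>V_mat n \<alpha>\<close>, which has determinant
  1.\<close>

lemma det_hankel_shear:
  fixes h :: "nat \<Rightarrow> 'a :: field"
  shows "det (hankel n (shear \<alpha> h)) = det (hankel n h)"
proof -
  let ?V = "poly_cols n (\<lambda>j. [:\<alpha>, 1:] ^ j)"
  have "hankel n (shear \<alpha> h) = transpose_mat ?V * hankel n h * ?V"
    by (subst hankel_congruence) (auto simp: degree_linear_power hankel_def shear_def power_add)
  then show ?thesis
    using det_V_mat[of n \<alpha>] by (simp add: V_mat_poly_cols det_mult[where n = n] det_transpose[where n = n]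
        mult_carrier_mat[where n = n])
qed

section \<open>Directions of affine growth of the determinant\<close>

text \<open>The graph of the determinant along \<open>h\<close> is compared with the line through
  its values at \<open>t = 0\<close> and \<open>t = 1\<close>. Only determinants occur, so the
  property can be carried along a linear bijection that preserves them.\<close>

definition affine_dir :: "nat \<Rightarrow> (nat \<Rightarrow> 'a :: field) \<Rightarrow> bool" where
  "affine_dir n h \<longleftrightarrow> (\<forall>g t. det (hankel n (\<lambda>k. g k + t * h k)) =
     det (hankel n g) + t * (det (hankel n (\<lambda>k. g k + h k)) - det (hankel n g)))"

text \<open>Shears are invertible and preserve the determinant, so every base point \<open>g\<close>
  is the shear of some \<open>f\<close>, and the claim at \<open>g\<close> is the assumption at
  \<open>f\<close>.\<close>

lemma affine_dir_shear:
  assumes "affine_dir n h"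
  shows "affine_dir n (shear \<alpha> h)"
  unfolding affine_dir_def
proof (intro allI)
  fix g t
  define f where "f = shear (- \<alpha>) g"
  have g: "shear \<alpha> f = g"
    by (simp add: f_def shear_shear_uminus)
  have "det (hankel n (\<lambda>k. g k + t * shear \<alpha> h k)) = det (hankel n (\<lambda>k. f k + t * h k))" for t
    using det_hankel_shear[of n \<alpha> "\<lambda>k. f k + t * h k"] by (simp add: shear_lincomb g)
  from this[of 1] this[of t] show "det (hankel n (\<lambda>k. g k + t * shear \<alpha> h k)) =
     det (hankel n g) + t * (det (hankel n (\<lambda>k. g k + shear \<alpha> h k)) - det (hankel n g))"
    using assms det_hankel_shear[of n \<alpha> f] by (simp add: affine_dir_def g)
qed

text \<open>Makes a determinant depending on \<open>t\<close> a polynomial, whose coefficients can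
  then be compared.\<close>

lemma det_poly_fun:
  fixes c :: "nat \<Rightarrow> nat \<Rightarrow> 'a :: field poly"
  shows "det (mat n n (\<lambda>(i, j). poly (c i j) t)) = poly (det (mat n n (\<lambda>(i, j). c i j))) t"
proof -
  interpret comm_ring_hom "\<lambda>p :: 'a poly. poly p t"
    by unfold_locales simp_all
  have "mat n n (\<lambda>(i, j). poly (c i j) t) = map_mat (\<lambda>p. poly p t) (mat n n (\<lambda>(i, j). c i j))"
    by (rule eq_matI) auto
  then show ?thesis by simp
qed

lemma det_2: "det (mat 2 2 f) = f (0, 0) * f (1, 1) - f (0, 1) * (f (1, 0) :: 'a :: comm_ring_1)"
proof -
  have "det (mat_delete (mat 2 2 f) 0 j) = f (1, 1 - j)" if "j < 2" for j
    using that by (subst det_single) (auto simp: mat_delete_def)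
  then show ?thesis
    by (subst laplace_expansion_row[of _ 2 0])
      (simp_all add: cofactor_def numeral_2_eq_2)
qed

text \<open>Adding \<^term>\<open>t\<close> times a Hankel matrix to one of rank \<^term>\<open>m\<close> gives a determinant
  divisible by \<^term>\<open>t\<^sup>2\<close>, and the coefficient of \<^term>\<open>t\<^sup>2\<close> is, up to sign, the lower right minor.\<close>

lemma affine_dir_minor:
  fixes h :: "nat \<Rightarrow> 'a :: field_char_0"
  assumes "affine_dir (m + 2) h"
  shows "h (2 * m) * h (2 * m + 2) = h (2 * m + 1) ^ 2"
proof -
  \<comment> \<open>The Hankel matrix of \<open>g\<close> has \<open>F_mat m\<close> as its upper
    left block and zeros elsewhere, hence rank \<open>m\<close>.\<close>
  define g :: "nat \<Rightarrow> 'a" where "g k = (if k + 1 = m then 1 else 0)" for k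
  \<comment> \<open>The last two rows of the sum are multiples of \<open>t\<close>; \<open>c\<close>
    is what remains once these two factors are taken out.\<close>
  define c where "c i j = (if i < m then [:g (i + j), h (i + j):] else [:h (i + j):])" for i j
  define d where "d = det (mat (m + 2) (m + 2) (\<lambda>(i, j). c i j))"
  let ?C = "\<lambda>t. mat (m + 2) (m + 2) (\<lambda>(i, j). poly (c i j) t)"
  have det_C: "det (?C t) = poly d t" for t
    unfolding d_def by (rule det_poly_fun)
  have split: "det (hankel (m + 2) (\<lambda>k. g k + t * h k)) = t ^ 2 * poly d t" for t
  proof -
    let ?D = "mat_diag (m + 2) (\<lambda>i. if i < m then 1 else t)"
    have "hankel (m + 2) (\<lambda>k. g k + t * h k) = ?D * ?C t"
      by (subst mat_diag_mult_left[of _ _ "m + 2"], simp, rule eq_matI) (auto simp: hankel_def c_def g_def)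
    moreover have "det ?D = t ^ 2"
    proof -
      have "det ?D = prod_list (diag_mat ?D)"
        by (rule det_upper_triangular[OF _ mat_diag_dim]) (auto simp: mat_diag_def)
      then show ?thesis
        by (simp add: prod_list_diag_prod mat_diag_def power2_eq_square)
    qed
    ultimately show ?thesis
      by (simp only: det_mult[OF mat_diag_dim mat_carrier] det_C)
  qed
  define q where "q = det (hankel (m + 2) (\<lambda>k. g k + h k))"
  have det_g: "det (hankel (m + 2) g) = 0"
    using split[of 0] by simp
  have affine: "t ^ 2 * poly d t = t * q" for t
    using assms split[of t] det_g by (simp add: affine_dir_def q_def)
  \<comment> \<open>The identity holds at every point of an infinite field, so one factor
    \<open>x\<close> cancels as a polynomial. Evaluating the rest at 0 then kills first
    \<open>q\<close> and after it \<open>d\<close>.\<close>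
  have "poly ([:0, 1:] * ([:0, 1:] * d)) = poly ([:0, 1:] * [:q:])"
    using affine by (auto simp: power2_eq_square algebra_simps)
  then have "[:0, 1:] * d = [:q:]"
    by (simp only: poly_eq_poly_eq_iff mult_cancel_left) simp
  moreover from arg_cong[OF this, of "\<lambda>p. poly p 0"] have "q = 0"
    by simp
  ultimately have "d = 0"
    by simp
  \<comment> \<open>At \<open>t = 0\<close> the upper rows are those of \<open>g\<close>, which
    leaves a block lower triangular matrix.\<close>
  have "four_block_mat (F_mat m) (0\<^sub>m m 2) (mat 2 m (\<lambda>(i, j). h (m + i + j)))
      (mat 2 2 (\<lambda>(i, j). h (2 * m + i + j))) = ?C 0"
    by (rule eq_matI) (auto simp: c_def g_def F_mat_def intro!: arg_cong[of _ _ h])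
  then have "det (?C 0) = det (F_mat m) * det (mat 2 2 (\<lambda>(i, j). h (2 * m + i + j)))"
    using det_four_block_mat_upper_right_zero[of "F_mat m" m "0\<^sub>m m 2" 2
        "mat 2 m (\<lambda>(i, j). h (m + i + j))" "mat 2 2 (\<lambda>(i, j). h (2 * m + i + j))"]
    by simp
  then have "det (mat 2 2 (\<lambda>(i, j). h (2 * m + i + j))) = 0"
    using det_C[of 0] \<open>d = 0\<close> det_F_mat_nonzero[of m, where ?'a = 'a] by simp
  then show ?thesis
    by (simp add: det_2 power2_eq_square)
qed

section \<open>The Hessian equation and the classification of affine directions\<close>

lemma lead_coeff_pderiv:
  "lead_coeff (pderiv p) = of_nat (degree p) * lead_coeff p" for p :: "'a :: field_char_0 poly"
  by (cases "degree p") (auto simp: degree_pderiv coeff_pderiv pderiv_eq_0_iff[THEN iffD2])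

text \<open>A polynomial solving this equation is an \<^term>\<open>N\<close>-th power of a linear form: with \<^term>\<open>e\<close>
  chosen to cancel the two top coefficients of \<open>u = N g - (X + e) g'\<close>, the equation becomes
  \<open>u g'' = g' u'\<close>, whose leading coefficients do not match unless \<open>u = 0\<close>.\<close>

lemma hessian_zero:
  fixes g :: "'a :: field_char_0 poly"
  assumes ode: "of_nat N * (g * pderiv (pderiv g)) = of_nat (N - 1) * pderiv g ^ 2"
    and N: "N \<ge> 2"
  shows "degree g = 0 \<or> (\<exists>e. of_nat N * g = [:e, 1:] * pderiv g)"
proof (cases "degree g = 0")
  case False
  define c where "c = lead_coeff g"
  have c: "c \<noteq> 0" using False by (auto simp: c_def)
  have lc1: "lead_coeff (pderiv g) = of_nat (degree g) * c"
    by (simp add: lead_coeff_pderiv c_def)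
  have lc2: "lead_coeff (pderiv (pderiv g)) = of_nat ((degree g - 1) * degree g) * c"
    using lead_coeff_pderiv[of "pderiv g"] lc1 by (simp add: degree_pderiv mult.assoc)
  \<comment> \<open>With \<open>d = degree g > 0\<close>, the leading coefficients give
    \<open>N * (d - 1) = (N - 1) * d\<close>, that is, \<open>d = N\<close>.\<close>
  have "lead_coeff (of_nat N * (g * pderiv (pderiv g))) = lead_coeff (of_nat (N - 1) * pderiv g ^ 2)"
    by (simp only: ode)
  then have "of_nat N * (c * (of_nat ((degree g - 1) * degree g) * c)) =
      of_nat (N - 1) * (of_nat (degree g) * c) ^ 2"
    by (simp only: lead_coeff_mult lead_coeff_of_nat lead_coeff_power lc1 lc2 c_def[symmetric])
  then have "of_nat (N * (degree g - 1) * degree g) * c ^ 2 =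
      of_nat ((N - 1) * degree g * degree g) * c ^ 2"
    by (simp add: power2_eq_square mult_ac)
  then have "N * (degree g - 1) * degree g = (N - 1) * degree g * degree g"
    using c by (simp only: mult_cancel_right power_eq_0_iff of_nat_eq_iff) simp
  then have "N * (degree g - 1) = (N - 1) * degree g"
    using False by simp
  then have deg: "degree g = N"
    using False N by (cases "degree g"; cases N) auto
  define e where "e = coeff g (N - 1) / (of_nat N * c)"
  define u where "u = of_nat N * g - [:e, 1:] * pderiv g"
  have "u = 0"
  proof (rule ccontr)
    assume u: "u \<noteq> 0"
    have coeff_of_nat: "coeff (of_nat k * g) i = of_nat k * coeff g i" for i k
      by (simp add: of_nat_poly)
    have "coeff u i = 0" if i: "i \<ge> N - 1" for i
    proof -
      consider "i = N - 1" | "i = N" | "i > N" using i by linarith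
      then show ?thesis
      proof cases
        case 1
        then obtain k where "N = Suc (Suc k)" "i = Suc k"
          using N by (cases N; cases "N - 1") auto
        then show ?thesis
          using c deg unfolding u_def
          by (simp add: coeff_of_nat coeff_pCons coeff_pderiv e_def c_def del: of_nat_Suc)
            (simp add: algebra_simps)
      next
        case 2
        then show ?thesis using deg N unfolding u_def
          by (cases N) (simp_all add: coeff_of_nat coeff_pCons coeff_pderiv coeff_eq_0 del: of_nat_Suc)
      next
        case 3
        then show ?thesis using deg unfolding u_def
          by (cases i) (simp_all add: coeff_of_nat coeff_pCons coeff_pderiv coeff_eq_0)
      qed
    qed
    then have deg_u: "degree u < N - 1"
      using u by (metis leading_coeff_0_iff not_le)
    have du: "pderiv u = of_nat N * pderiv g - pderiv g - [:e, 1:] * pderiv (pderiv g)"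
      by (simp add: u_def pderiv_diff pderiv_mult pderiv_pCons del: mult_pCons_left)
    have N1: "of_nat (N - 1) = (of_nat N - 1 :: 'a poly)"
      using N by (simp add: of_nat_diff)
    have "u * pderiv (pderiv g) =
        of_nat N * (g * pderiv (pderiv g)) - [:e, 1:] * (pderiv g * pderiv (pderiv g))"
      by (simp only: u_def left_diff_distrib mult.assoc)
    also have "\<dots> = pderiv g * pderiv u"
      unfolding ode du N1 by (simp add: algebra_simps power2_eq_square del: mult_pCons_left mult_pCons_right)
    finally have "u * pderiv (pderiv g) = pderiv g * pderiv u" .
    then have "lead_coeff (u * pderiv (pderiv g)) = lead_coeff (pderiv g * pderiv u)"
      by simp
    then have "of_nat (N - 1) * (lead_coeff u * of_nat N * c) = of_nat (degree u) * (lead_coeff u * of_nat N * c)"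
      by (simp only: lead_coeff_mult lc1 lc2 lead_coeff_pderiv[of u] deg of_nat_mult mult_ac)
    then have "N - 1 = degree u"
      using c u N by (simp only: mult_cancel_right of_nat_eq_iff) auto
    with deg_u show False by simp
  qed
  then show ?thesis
    by (auto simp: u_def)
qed simp

text \<open>The binary form of degree \<open>N\<close> with binomially weighted coefficients
  \<open>h\<close>, dehomogenized. Its value at \<open>\<alpha>\<close> is the \<open>N\<close>-th
  entry of the shear by \<open>\<alpha>\<close>.\<close>

definition shear_poly :: "nat \<Rightarrow> (nat \<Rightarrow> 'a) \<Rightarrow> 'a :: comm_ring_1 poly" where
  "shear_poly N h = (\<Sum>i\<le>N. monom (of_nat (N choose i) * h (N - i)) i)"

lemma coeff_shear_poly:
  "coeff (shear_poly N h) i = (if i \<le> N then of_nat (N choose i) * h (N - i) else 0)"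
  by (simp add: shear_poly_def coeff_sum)

lemma poly_shear_poly: "poly (shear_poly N h) \<alpha> = shear \<alpha> h N"
proof -
  have "shear \<alpha> h N = (\<Sum>i\<le>N. of_nat (N choose i) * \<alpha> ^ (N - i) * h i)"
    unfolding shear_def
    by (subst mom_bound[where d = N]) (auto simp: degree_linear_power coeff_linear_poly_power
        intro!: sum.cong)
  also have "\<dots> = (\<Sum>i\<le>N. of_nat (N choose (N - i)) * \<alpha> ^ i * h (N - i))"
    by (rule sum.reindex_bij_witness[of _ "\<lambda>i. N - i" "\<lambda>i. N - i"]) auto
  also have "\<dots> = poly (shear_poly N h) \<alpha>"
    by (auto simp: shear_poly_def poly_sum poly_monom binomial_symmetric[symmetric] mult_ac intro!: sum.cong)
  finally show ?thesis ..
qed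

text \<open>An Appell sequence: shears at three consecutive indices become, up to constants, a
  polynomial and its first two derivatives.\<close>

lemma pderiv_shear_poly: "pderiv (shear_poly (Suc N) h) = of_nat (Suc N) * shear_poly N h"
proof (rule poly_eqI)
  fix i
  have "of_nat (Suc i) * of_nat (Suc N choose Suc i) = (of_nat (Suc N) * of_nat (N choose i) :: 'a)"
    by (metis Suc_times_binomial_eq of_nat_mult mult.commute)
  then show "coeff (pderiv (shear_poly (Suc N) h)) i = coeff (of_nat (Suc N) * shear_poly N h) i"
    by (simp add: coeff_pderiv coeff_shear_poly of_nat_poly mult.assoc[symmetric] del: of_nat_Suc binomial_Suc_Suc)
qed

text \<open>The minor from \<open>affine_dir_minor\<close> vanishes for all shears of
  \<open>h\<close>, which is a polynomial identity in the shear parameter, namely the equation of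
  \<open>hessian_zero\<close>. The first alternative is the node at infinity; in the second,
  \<open>h\<close> has node \<open>e\<close>.\<close>

lemma affine_dir_cases:
  fixes h :: "nat \<Rightarrow> 'a :: field_char_0"
  assumes "affine_dir n h" "n \<ge> 2"
  obtains "\<And>i. i < 2 * n - 2 \<Longrightarrow> h i = 0"
  | c e where "\<And>i. i \<le> 2 * n - 2 \<Longrightarrow> h i = c * e ^ i"
proof -
  define m where "m = n - 2"
  define N where "N = 2 * m + 2"
  define g where "g = shear_poly N h"
  have n: "n = m + 2" "2 * n - 2 = N"
    using assms(2) by (simp_all add: m_def N_def)
  have N: "N = Suc (Suc (2 * m))" by (simp add: N_def)
  have g1: "pderiv g = of_nat N * shear_poly (Suc (2 * m)) h"
    unfolding g_def N by (rule pderiv_shear_poly)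
  have g2: "pderiv (pderiv g) = of_nat N * (of_nat (N - 1) * shear_poly (2 * m) h)"
    unfolding g1 by (simp add: pderiv_mult pderiv_shear_poly N del: of_nat_Suc)
  have "poly (g * shear_poly (2 * m) h) \<alpha> = poly (shear_poly (Suc (2 * m)) h ^ 2) \<alpha>" for \<alpha>
    using affine_dir_minor[OF affine_dir_shear[OF assms(1), unfolded n], of \<alpha>]
    by (simp add: g_def poly_shear_poly N mult.commute)
  then have "g * shear_poly (2 * m) h = shear_poly (Suc (2 * m)) h ^ 2"
    using poly_eq_poly_eq_iff by blast
  then have "of_nat N * (g * pderiv (pderiv g)) = of_nat (N - 1) * pderiv g ^ 2"
    unfolding g2 unfolding g1 by (simp add: power_mult_distrib power2_eq_square[of "of_nat N"] algebra_simps)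
  from hessian_zero[OF this] have "degree g = 0 \<or> (\<exists>e. of_nat N * g = [:e, 1:] * pderiv g)"
    by (simp add: N)
  then show thesis
  proof
    assume deg: "degree g = 0"
    show thesis
    proof (rule that(1))
      fix i assume "i < 2 * n - 2"
      then have "i < N" using n(2) by simp
      then have "coeff g (N - i) = 0"
        using deg by (simp add: coeff_eq_0)
      then show "h i = 0"
        using \<open>i < N\<close> by (auto simp: g_def coeff_shear_poly split: if_splits)
    qed
  next
    assume "\<exists>e. of_nat N * g = [:e, 1:] * pderiv g"
    then obtain e where e: "of_nat N * g = [:e, 1:] * pderiv g" ..
    have step: "h (Suc i) = e * h i" if "i < N" for i
    proof -
      \<comment> \<open>\<open>shear_poly\<close> reverses indices, so \<open>h (Suc i)\<close> sits
        in the coefficient of index \<open>N - Suc i\<close>. Comparing this coefficient gives the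
        recursion after the binomial coefficients are absorbed.\<close>
      define k where "k = N - Suc i"
      have k: "Suc k = N - i" "N = Suc (k + i)" "k \<le> N" using that by (auto simp: k_def)
      have "coeff (of_nat N * g) k = coeff ([:e, 1:] * pderiv g) k"
        by (simp only: e)
      then have "of_nat N * coeff g k = e * (of_nat (Suc k) * coeff g (Suc k)) + of_nat k * coeff g k"
        by (cases k) (simp_all add: of_nat_poly coeff_pderiv coeff_pCons algebra_simps)
      then have "of_nat (Suc i) * coeff g k = e * (of_nat (Suc k) * coeff g (Suc k))"
        by (simp add: k(2) algebra_simps)
      moreover have "coeff g k = of_nat (N choose k) * h (Suc i)"
        "coeff g (Suc k) = of_nat (N choose Suc k) * h i"
        using k by (auto simp: g_def coeff_shear_poly)
      moreover have "Suc k * (N choose Suc k) = Suc i * (N choose k)"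
        using binomial_absorb_comp[of N k] binomial_absorption[of k N] k(2) by simp
      then have "of_nat (Suc k) * of_nat (N choose Suc k) = (of_nat (Suc i) * of_nat (N choose k) :: 'a)"
        by (metis of_nat_mult)
      ultimately have "of_nat (Suc i) * of_nat (N choose k) * h (Suc i) =
          of_nat (Suc i) * of_nat (N choose k) * (e * h i)"
        by (simp add: mult_ac del: of_nat_Suc)
      moreover have "of_nat (Suc i) * of_nat (N choose k) \<noteq> (0 :: 'a)"
        using k(3) by (simp del: of_nat_Suc)
      ultimately show ?thesis by simp
    qed
    show thesis
    proof (rule that(2))
      fix i assume "i \<le> 2 * n - 2"
      then have "i \<le> N" using n(2) by simp
      then show "h i = h 0 * e ^ i"
        by (induction i) (simp_all add: step)
    qed
  qed
qed

section \<open>Changing one corner entry, and the converse for geometric sequences\<close>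

lemma det_corner:
  fixes A B :: "'a :: comm_ring_1 mat"
  assumes "A \<in> carrier_mat n n" "B \<in> carrier_mat n n" "k < n"
    and "\<And>i j. i < n \<Longrightarrow> j < n \<Longrightarrow> (i, j) \<noteq> (k, k) \<Longrightarrow> B $$ (i, j) = A $$ (i, j)"
  shows "det B = det A + (B $$ (k, k) - A $$ (k, k)) * det (mat_delete A k k)"
proof -
  \<comment> \<open>Deleting row \<open>k\<close> removes the only entry in which the matrices
    differ, so the cofactors along that row agree.\<close>
  have "mat_delete B k j = mat_delete A k j" if "j < n" for j
    unfolding mat_delete_def using assms that by (intro cong_mat) auto
  then have cof: "cofactor B k j = cofactor A k j" if "j < n" for j
    using that by (simp add: cofactor_def)
  have "det B = (\<Sum>j<n. A $$ (k, j) * cofactor A k j +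
      (if j = k then (B $$ (k, k) - A $$ (k, k)) * cofactor A k k else 0))"
    unfolding laplace_expansion_row[OF assms(2,3)]
    using assms by (intro sum.cong) (auto simp: cof algebra_simps)
  also have "\<dots> = det A + (B $$ (k, k) - A $$ (k, k)) * cofactor A k k"
    unfolding laplace_expansion_row[OF assms(1,3)] using assms(3) by (simp add: sum.distrib)
  finally show ?thesis by (simp add: cofactor_def)
qed

lemma det_hankel_last:
  assumes "n \<ge> 1" "\<And>i. i < 2 * n - 2 \<Longrightarrow> h i = 0"
  shows "det (hankel n (\<lambda>k. g k + h k)) =
    det (hankel n g) + h (2 * n - 2) * det (hankel (n - 1) g :: 'a :: field mat)"
proof -
  have "det (hankel n (\<lambda>k. g k + h k)) = det (hankel n g) +
      (hankel n (\<lambda>k. g k + h k) $$ (n - 1, n - 1) - hankel n g $$ (n - 1, n - 1)) *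
      det (mat_delete (hankel n g) (n - 1) (n - 1))"
  proof (rule det_corner)
    fix i j assume "i < n" "j < n" "(i, j) \<noteq> (n - 1, n - 1)"
    then have "i + j < 2 * n - 2" by auto
    then show "hankel n (\<lambda>k. g k + h k) $$ (i, j) = hankel n g $$ (i, j)"
      using \<open>i < n\<close> \<open>j < n\<close> assms by (simp add: hankel_def)
  qed (use assms(1) in auto)
  moreover have "mat_delete (hankel n g) (n - 1) (n - 1) = hankel (n - 1) g"
    by (rule eq_matI) (auto simp: mat_delete_def hankel_def)
  moreover have "n - 1 + (n - 1) = 2 * n - 2" by simp
  ultimately show ?thesis
    using assms(1) by (simp add: hankel_def)
qed

text \<open>The counterpart of \<open>det_hankel_last\<close> for the node 0. Removing the first row
  and the first column raises the index sum by two, whence \<open>g (k + 2)\<close>.\<close>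

lemma det_hankel_first:
  assumes "n \<ge> 1" "\<And>i. 0 < i \<Longrightarrow> i \<le> 2 * n - 2 \<Longrightarrow> h i = 0"
  shows "det (hankel n (\<lambda>k. g k + h k)) =
    det (hankel n g) + h 0 * det (hankel (n - 1) (\<lambda>k. g (k + 2)) :: 'a :: field mat)"
proof -
  have "det (hankel n (\<lambda>k. g k + h k)) = det (hankel n g) +
      (hankel n (\<lambda>k. g k + h k) $$ (0, 0) - hankel n g $$ (0, 0)) *
      det (mat_delete (hankel n g) 0 0)"
  proof (rule det_corner)
    fix i j assume "i < n" "j < n" "(i, j) \<noteq> (0, 0)"
    then have "0 < i + j" "i + j \<le> 2 * n - 2" by auto
    then show "hankel n (\<lambda>k. g k + h k) $$ (i, j) = hankel n g $$ (i, j)"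
      using \<open>i < n\<close> \<open>j < n\<close> assms by (simp add: hankel_def)
  qed (use assms(1) in auto)
  moreover have "mat_delete (hankel n g) 0 0 = hankel (n - 1) (\<lambda>k. g (k + 2))"
    by (rule eq_matI) (auto simp: mat_delete_def hankel_def)
  ultimately show ?thesis
    using assms(1) by (simp add: hankel_def)
qed

text \<open>The shear moves the node \<open>e\<close> to 0, where a geometric sequence lives in its
  entry 0 only.\<close>

lemma shear_geometric:
  assumes "\<And>i. i \<le> N \<Longrightarrow> h i = c * e ^ i" "k \<le> N"
  shows "shear (- e) h k = (c * 0 ^ k :: 'a :: field)"
proof -
  have "shear (- e) h k = mom (\<lambda>i. c * e ^ i) ([:- e, 1:] ^ k)"
    unfolding shear_def using assms by (intro mom_cong) (auto simp: degree_linear_power)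
  then show ?thesis by (simp add: mom_power)
qed

text \<open>After the node is moved to 0, the direction changes a single corner entry, in which the
  determinant is affine; shearing back keeps this.\<close>

lemma affine_dir_geometric:
  assumes "n \<ge> 1" "\<And>i. i \<le> 2 * n - 2 \<Longrightarrow> h i = c * e ^ i"
  shows "affine_dir n h"
proof -
  let ?h = "shear (- e) h"
  have "?h i = 0" if "0 < i" "i \<le> 2 * n - 2" for i
    using shear_geometric[of "2 * n - 2" h c e i] assms(2) that by simp
  then have "affine_dir n ?h"
    unfolding affine_dir_def
    using det_hankel_first[OF assms(1), of "\<lambda>k. t * ?h k" for t] det_hankel_first[OF assms(1), of ?h]
    by (simp add: algebra_simps)
  from affine_dir_shear[OF this, of e] show ?thesis
    by (simp add: shear_shear_uminus)
qed

text \<open>Such an \<open>h\<close> is an affine direction of slope 0, so the classification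
  applies, and only one scalar remains to be shown zero. This will give injectivity of a determinant
  preserver.\<close>

lemma det_hankel_nondegenerate:
  fixes h :: "nat \<Rightarrow> 'a :: field_char_0"
  assumes n: "n \<ge> 2"
    and radical: "\<And>g t. det (hankel n (\<lambda>k. g k + t * h k)) = det (hankel n g)"
    and i: "i \<le> 2 * n - 2"
  shows "h i = 0"
proof -
  \<comment> \<open>A test sequence for which the minor of size \<open>n - 1\<close> is nonsingular,
    so that it detects the corner entry.\<close>
  have F: "hankel (n - 1) (\<lambda>k. if k = n - 2 then 1 else 0) = (F_mat (n - 1) :: 'a mat)"
    using n by (intro eq_matI) (auto simp: hankel_def F_mat_def)
  have radical1: "det (hankel n (\<lambda>k. g k + h k)) = det (hankel n g)" for g
    using radical[of g 1] by simp
  have "affine_dir n h"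
    using radical by (simp add: affine_dir_def radical1)
  then show ?thesis
    using n
  proof (cases rule: affine_dir_cases)
    case 1
    then have "h (2 * n - 2) * det (hankel (n - 1) (\<lambda>k. if k = n - 2 then 1 else 0)) = 0"
      using det_hankel_last[of n h] radical1 n by simp
    then have "h (2 * n - 2) = 0"
      unfolding F by (simp add: det_F_mat_nonzero)
    then show ?thesis
      using 1 i by (cases "i = 2 * n - 2") auto
  next
    case (2 c e)
    let ?h = "shear (- e) h"
    have h: "?h i = c * 0 ^ i" if "i \<le> 2 * n - 2" for i
      using shear_geometric[of "2 * n - 2" h c e i] 2 that by simp
    have "det (hankel n (\<lambda>k. g k + ?h k)) = det (hankel n g)" for g
    proof -
      have "det (hankel n (\<lambda>k. g k + ?h k)) = det (hankel n (shear e (\<lambda>k. g k + 1 * ?h k)))"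
        by (simp add: det_hankel_shear)
      also have "\<dots> = det (hankel n (\<lambda>k. shear e g k + h k))"
        by (simp only: shear_lincomb) (simp add: shear_shear_uminus)
      finally show ?thesis by (simp add: radical1 det_hankel_shear)
    qed
    \<comment> \<open>The base point has its 1 at index \<open>n\<close>; the shift by two in
      \<open>det_hankel_first\<close> moves it to \<open>n - 2\<close>, as in
      \<open>F\<close>.\<close>
    then have "?h 0 * det (hankel (n - 1) (\<lambda>k. if k + 2 = n then 1 else 0)) = 0"
      using det_hankel_first[of n ?h "\<lambda>k. if k = n then 1 else 0"] h n by simp
    moreover have "(\<lambda>k. if k + 2 = n then 1 else 0) = (\<lambda>k. if k = n - 2 then 1 else (0 :: 'a))"
      using n by (intro ext) auto
    ultimately have "?h 0 * det (F_mat (n - 1)) = 0"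
      by (simp only: F)
    then have "c = 0"
      using h[of 0] by (simp add: det_F_mat_nonzero)
    then show ?thesis using 2 i by simp
  qed
qed

section \<open>Toeplitz matrices and pairs of linear forms\<close>

lemma toeplitz_mats_carrier: "A \<in> toeplitz_mats n \<Longrightarrow> A \<in> carrier_mat n n"
  by (auto simp: toeplitz_mats_def)

lemma F_mult_hankel_toeplitz: "F_mat n * hankel n h \<in> toeplitz_mats n"
proof -
  have "F_mat n * hankel n h = mat n n (\<lambda>(i, j). h (nat (int (n - 1) - (int i - int j))))"
    by (subst F_mat_mult_left[where m = n], simp, rule eq_matI) (auto simp: hankel_def intro!: arg_cong[of _ _ h])
  then show ?thesis
    unfolding toeplitz_mats_def by (intro CollectI exI[of _ "\<lambda>k. h (nat (int (n - 1) - k))"])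
qed

text \<open>Inverts the passage from \<open>h\<close> to \<open>F_mat n * hankel n h\<close> on the
  indices up to \<open>2 * n - 2\<close>: along the last row, then up the last column.\<close>

definition toeplitz_seq :: "nat \<Rightarrow> 'a mat \<Rightarrow> nat \<Rightarrow> 'a" where
  "toeplitz_seq n A k = (if k < n then A $$ (n - 1, k) else A $$ (2 * n - 2 - k, n - 1))"

lemma toeplitz_conv_hankel:
  assumes "A \<in> toeplitz_mats n"
  shows "A = F_mat n * hankel n (toeplitz_seq n A)"
proof -
  from assms obtain a where A: "A = mat n n (\<lambda>(i, j). a (int i - int j))"
    by (auto simp: toeplitz_mats_def)
  show ?thesis
    by (subst F_mat_mult_left[where m = n], simp, subst A, rule eq_matI)
      (auto simp: A hankel_def toeplitz_seq_def intro!: arg_cong[of _ _ a])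
qed

lemma toeplitz_seq_F_hankel:
  assumes "k \<le> 2 * n - 2" "n \<ge> 1"
  shows "toeplitz_seq n (F_mat n * hankel n h) k = h k"
  using assms
  by (subst F_mat_mult_left[where m = n]) (auto simp: toeplitz_seq_def hankel_def intro!: arg_cong[of _ _ h])

lemma F_mult_hankel_lincomb:
  "F_mat n * hankel n (\<lambda>k. g k + t * h k) = F_mat n * hankel n g + t \<cdot>\<^sub>m (F_mat n * hankel n h)"
  by (simp add: F_mat_mult_left[where m = n], rule eq_matI) (auto simp: hankel_def)

lemma one_mat_toeplitz: "1\<^sub>m n \<in> toeplitz_mats n"
  unfolding toeplitz_mats_def
  by (intro CollectI exI[of _ "\<lambda>k. if k = 0 then 1 else 0"] eq_matI) auto

lemma smult_toeplitz: "A \<in> toeplitz_mats n \<Longrightarrow> c \<cdot>\<^sub>m A \<in> toeplitz_mats n" for c :: "'a :: field"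
  unfolding toeplitz_mats_def
proof (elim CollectE exE, intro CollectI)
  fix a assume "A = mat n n (\<lambda>(i, j). a (int i - int j))"
  then show "\<exists>a. c \<cdot>\<^sub>m A = mat n n (\<lambda>(i, j). a (int i - int j))"
    by (intro exI[of _ "\<lambda>k. c * a k"] eq_matI) auto
qed

text \<open>The cross relations say that \<^term>\<open>P 1 / P 0\<close> is the common ratio of a geometric progression;
  writing it as \<^term>\<open>B / A\<close> in lowest terms forces \<^term>\<open>A ^ N\<close> to divide \<^term>\<open>P 0\<close>.\<close>

lemma proportional_polys:
  fixes P :: "nat \<Rightarrow> 'a :: {field_char_0, field_gcd} poly"
  assumes N: "N \<ge> 1"
    and deg: "\<And>k. k \<le> N \<Longrightarrow> degree (P k) \<le> N"
    and cross: "\<And>k. k < N \<Longrightarrow> P 0 * P (Suc k) = P 1 * P k"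
    and nz: "P 0 \<noteq> 0"
    and indep: "\<And>c. P 1 \<noteq> smult c (P 0)"
  obtains A B c where "degree A \<le> 1" "degree B \<le> 1" "c \<noteq> 0"
    "\<And>k. k \<le> N \<Longrightarrow> P k = smult c (A ^ (N - k) * B ^ k)"
proof -
  define g where "g = gcd (P 0) (P 1)"
  have g: "g \<noteq> 0" using nz by (simp add: g_def)
  define A where "A = P 0 div g"
  define B where "B = P 1 div g"
  have P0: "P 0 = A * g" and P1: "P 1 = B * g"
    by (simp_all add: A_def B_def g_def)
  have A: "A \<noteq> 0" using nz P0 by auto
  have B: "B \<noteq> 0" using indep[of 0] P1 by auto
  have "coprime A B"
    unfolding A_def B_def g_def using nz by (intro div_gcd_coprime) simp
  \<comment> \<open>The relation \<open>P k = (B / A)^k * P 0\<close>, cleared of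
    denominators.\<close>
  have power: "A ^ k * P k = B ^ k * P 0" if "k \<le> N" for k
    using that
  proof (induction k)
    case (Suc k)
    have "g * (A * P (Suc k)) = g * (B * P k)"
      using cross[of k] Suc.prems unfolding P0 P1 by (simp add: mult_ac)
    then have "A * P (Suc k) = B * P k" using g by simp
    then have "A ^ Suc k * P (Suc k) = B * (A ^ k * P k)"
      by (simp add: mult_ac)
    also have "\<dots> = B * (B ^ k * P 0)"
      using Suc by simp
    finally show ?case by (simp only: power_Suc mult.assoc)
  qed simp
  have "A ^ N dvd B ^ N * P 0"
    using power[of N] by (metis dvd_triv_left le_refl)
  then have "A ^ N dvd P 0"
    using \<open>coprime A B\<close> by (simp add: coprime_dvd_mult_right_iff)
  then obtain G where G: "P 0 = A ^ N * G" ..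
  have G0: "G \<noteq> 0" using G nz by auto
  have P: "P k = G * (A ^ (N - k) * B ^ k)" if "k \<le> N" for k
  proof -
    have "A ^ k * P k = A ^ k * (G * (A ^ (N - k) * B ^ k))"
      using power[OF that] that
      by (simp add: G mult_ac) (simp add: mult.assoc[symmetric] power_add[symmetric])
    then show ?thesis using A by simp
  qed
  have dA: "degree G + N * degree A \<le> N"
    using deg[of 0] A G0 by (simp add: G degree_mult_eq degree_power_eq add.commute)
  have dB: "degree G + N * degree B \<le> N"
    using deg[of N] P[of N] B G0 by (simp add: degree_mult_eq degree_power_eq)
  have le1: "d \<le> 1" if "degree G + N * d \<le> N" for d
  proof (rule ccontr)
    assume "\<not> d \<le> 1"
    then have "N * 2 \<le> N * d" by simp
    then show False using that N by linarith
  qed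
  \<comment> \<open>A nonconstant \<open>G\<close> uses up part of the degree bound
    \<open>N\<close>, so \<open>A\<close> and \<open>B\<close> would both be constant and
    \<open>P 1\<close> a multiple of \<open>P 0\<close>.\<close>
  have "degree G = 0"
  proof (rule ccontr)
    assume dG: "degree G \<noteq> 0"
    have "d = 0" if "degree G + N * d \<le> N" for d
      using le1[OF that] that dG by (cases d) auto
    then have "degree A = 0" "degree B = 0" using dA dB by blast+
    then obtain a b where ab: "A = [:a:]" "B = [:b:]"
      by (metis degree_eq_zeroE)
    then have "P 1 = smult (b / a) (P 0)"
      using A unfolding P0 P1 by simp
    with indep show False by blast
  qed
  then obtain c where c: "G = [:c:]"
    by (metis degree_eq_zeroE)
  show thesis
    by (rule that[of A B c]) (use le1 dA dB P c G0 in auto)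
qed

text \<open>The symmetric power of order \<open>n - 1\<close> of the linear substitution given by
  the pair \<open>A\<close>, \<open>B\<close>, where a constant counts as a linear form with its
  zero at infinity.\<close>

definition param_mat :: "nat \<Rightarrow> 'a :: field poly \<Rightarrow> 'a poly \<Rightarrow> 'a mat" where
  "param_mat n A B = poly_cols n (\<lambda>j. A ^ (n - 1 - j) * B ^ j)"

lemma V_mat_D_param: "V_mat n \<alpha> * D_mat n r = param_mat n 1 (smult r [:\<alpha>, 1:])"
  by (simp add: V_mat_poly_cols poly_cols_mult_D param_mat_def smult_power del: smult_pCons)

lemma V_mat_F_D_param: "V_mat n \<alpha> * F_mat n * D_mat n r = param_mat n [:\<alpha>, 1:] [:r:]"
  by (simp add: V_mat_poly_cols poly_cols_mult_F poly_cols_mult_D param_mat_def poly_const_pow mult.commute)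

lemma W_mat_D_param: "W_mat n \<alpha> \<beta> * D_mat n r = param_mat n [:\<beta>, 1:] (smult r [:\<alpha>, 1:])"
  by (simp add: W_mat_poly_cols poly_cols_mult_D param_mat_def smult_power del: smult_pCons)

lemma degree_linear_product:
  fixes A B :: "'a :: field poly"
  assumes "degree A \<le> 1" "degree B \<le> 1"
  shows "degree (A ^ i * B ^ j) \<le> i + j"
proof -
  have "degree (p ^ k) \<le> k" if "degree p \<le> 1" for p :: "'a poly" and k
    using order.trans[OF degree_power_le mult_le_mono1[OF that]] by simp
  from this[OF assms(1), of i] this[OF assms(2), of j] show ?thesis
    using degree_mult_le[of "A ^ i" "B ^ j"] by linarith
qed

text \<open>In the product of columns \<open>i\<close> and \<open>j\<close> the exponents add up, so
  the entry depends on \<open>i + j\<close> alone and the congruence yields a Hankel matrix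
  again.\<close>

lemma hankel_param_mat:
  assumes "degree A \<le> 1" "degree B \<le> 1" "n \<ge> 1"
  shows "transpose_mat (param_mat n A B) * hankel n h * param_mat n A B =
    hankel n (\<lambda>k. mom h (A ^ (2 * n - 2 - k) * B ^ k))"
proof -
  have "degree (A ^ (n - 1 - j) * B ^ j) < n" if "j < n" for j
    using degree_linear_product[OF assms(1,2), of "n - 1 - j" j] that by simp
  then have "transpose_mat (param_mat n A B) * hankel n h * param_mat n A B =
      mat n n (\<lambda>(i, j). mom h ((A ^ (n - 1 - i) * B ^ i) * (A ^ (n - 1 - j) * B ^ j)))"
    unfolding param_mat_def by (rule hankel_congruence)
  also have "\<dots> = hankel n (\<lambda>k. mom h (A ^ (2 * n - 2 - k) * B ^ k))"
  proof (rule eq_matI)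
    fix i j assume "i < dim_row (hankel n (\<lambda>k. mom h (A ^ (2 * n - 2 - k) * B ^ k)))"
      "j < dim_col (hankel n (\<lambda>k. mom h (A ^ (2 * n - 2 - k) * B ^ k)))"
    then have ij: "i < n" "j < n" by (auto simp: hankel_def)
    then have "2 * n - 2 - (i + j) = (n - 1 - i) + (n - 1 - j)" by simp
    then have "(A ^ (n - 1 - i) * B ^ i) * (A ^ (n - 1 - j) * B ^ j) = A ^ (2 * n - 2 - (i + j)) * B ^ (i + j)"
      by (simp only: power_add mult_ac)
    then show "mat n n (\<lambda>(i, j). mom h ((A ^ (n - 1 - i) * B ^ i) * (A ^ (n - 1 - j) * B ^ j))) $$ (i, j) =
        hankel n (\<lambda>k. mom h (A ^ (2 * n - 2 - k) * B ^ k)) $$ (i, j)"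
      using ij by (simp add: hankel_def)
  qed (auto simp: hankel_def)
  finally show ?thesis .
qed

definition canonical :: "nat \<Rightarrow> 'a :: field \<Rightarrow> 'a mat \<Rightarrow> bool" where
  "canonical n r N \<longleftrightarrow> (\<exists>\<alpha>. N = V_mat n \<alpha> * D_mat n r) \<or>
     (\<exists>\<alpha>. N = V_mat n \<alpha> * F_mat n * D_mat n r) \<or>
     (\<exists>\<alpha> \<beta>. \<alpha> \<noteq> \<beta> \<and> N = W_mat n \<alpha> \<beta> * D_mat n r)"

lemma canonical_carrier: "canonical n r N \<Longrightarrow> N \<in> carrier_mat n n"
  by (auto simp: canonical_def V_mat_D_param V_mat_F_D_param W_mat_D_param) (simp_all add: param_mat_def)

text \<open>Independence means \<open>b * c \<noteq> a * d\<close> for the coefficients. A constant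
  \<open>A\<close> leads to form (1), a constant \<open>B\<close> to form (2), and two forms of
  degree one, with distinct roots, to form (3). A common scalar makes \<open>A\<close> equal to 1 or
  monic; \<open>r\<close> is what remains in front of \<open>B\<close>.\<close>

lemma linear_pair_normal_form:
  fixes A B :: "'a :: field poly"
  assumes "degree A \<le> 1" "degree B \<le> 1" "A \<noteq> 0" "\<And>c. B \<noteq> smult c A"
  obtains a r A' B' where "a \<noteq> 0" "r \<noteq> 0" "degree A' \<le> 1" "degree B' \<le> 1"
    "A = smult a A'" "B = smult a B'" "canonical n r (param_mat n A' B')"
proof -
  have linear: "\<exists>b a. p = [:b, a:]" if "degree p \<le> 1" for p :: "'a poly"
    using that by (cases p rule: pCons_cases; cases "p = 0") (auto split: if_splits elim!: degree_eq_zeroE)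
  obtain b a where A: "A = [:b, a:]" using linear[OF assms(1)] by blast
  obtain d c where B: "B = [:d, c:]" using linear[OF assms(2)] by blast
  have det: "b * c \<noteq> a * d"
  proof
    assume eq: "b * c = a * d"
    show False
    proof (cases "a = 0")
      case True
      then have "B = smult (d / b) A" using eq assms(3) by (auto simp: A B)
      with assms(4) show False by blast
    next
      case False
      then have "B = smult (c / a) A" using eq by (auto simp: A B field_simps)
      with assms(4) show False by blast
    qed
  qed
  consider "a = 0" "b \<noteq> 0" "c \<noteq> 0" | "a \<noteq> 0" "c = 0" "d \<noteq> 0" | "a \<noteq> 0" "c \<noteq> 0"
    using det by (metis mult_zero_left mult_zero_right)
  then show thesis
  proof cases
    case 1
    have "canonical n (c / b) (param_mat n 1 (smult (c / b) [:d / c, 1:]))"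
      unfolding canonical_def V_mat_D_param[symmetric] by blast
    then show thesis
      by (rule that[of b "c / b" 1 "smult (c / b) [:d / c, 1:]", rotated -1])
        (use 1 in \<open>auto simp: A B\<close>)
  next
    case 2
    have "canonical n (d / a) (param_mat n [:b / a, 1:] [:d / a:])"
      unfolding canonical_def V_mat_F_D_param[symmetric] by blast
    then show thesis
      by (rule that[of a "d / a" "[:b / a, 1:]" "[:d / a:]", rotated -1])
        (use 2 in \<open>auto simp: A B\<close>)
  next
    case 3
    then have "d / c \<noteq> b / a"
      using det by (auto simp: field_simps)
    then have "canonical n (c / a) (param_mat n [:b / a, 1:] (smult (c / a) [:d / c, 1:]))"
      unfolding canonical_def W_mat_D_param[symmetric] by blast
    then show thesis
      by (rule that[of a "c / a" "[:b / a, 1:]" "smult (c / a) [:d / c, 1:]", rotated -1])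
        (use 3 in \<open>auto simp: A B\<close>)
  qed
qed

section \<open>Determinant preservers\<close>

lemma left_factor_carrier: "N \<in> carrier_mat n n \<Longrightarrow> left_factor n \<gamma> N \<in> carrier_mat n n"
  by (simp add: left_factor_def mult_carrier_mat[where n = n])

text \<open>Because \<open>F_mat n\<close> is an involution, the two-sided multiplication of
  Toeplitz matrices is a scaled congruence of Hankel matrices.\<close>

lemma left_factor_mult_F_hankel:
  assumes N: "N \<in> carrier_mat n n"
  shows "left_factor n \<gamma> N * (F_mat n * hankel n h) * N =
    \<gamma> \<cdot>\<^sub>m (F_mat n * (transpose_mat N * hankel n h * N))"
proof -
  let ?F = "F_mat n :: 'a mat" and ?H = "hankel n h" and ?N = "transpose_mat N"
  have c: "?F \<in> carrier_mat n n" "?H \<in> carrier_mat n n" "?N \<in> carrier_mat n n"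
    using N by simp_all
  note m = mult_carrier_mat[where n = n and nr = n and nc = n]
  have "?F * ?N * ?F * (?F * ?H) = ?F * ?N * (?F * (?F * ?H))"
    by (rule assoc_mult_mat[of _ n n _ n _ n]) (intro m c)+
  also have "?F * (?F * ?H) = (?F * ?F) * ?H"
    by (rule assoc_mult_mat[of _ n n _ n _ n, symmetric]) (intro m c)+
  also have "\<dots> = ?H"
    by (simp add: F_mat_square left_mult_one_mat[OF c(2)])
  finally have "?F * ?N * ?F * (?F * ?H) * N = ?F * ?N * ?H * N" by simp
  also have "?F * ?N * ?H = ?F * (?N * ?H)"
    by (rule assoc_mult_mat[of _ n n _ n _ n]) (intro m c)+
  also have "\<dots> * N = ?F * (?N * ?H * N)"
    by (rule assoc_mult_mat[of _ n n _ n _ n]) (intro m c N)+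
  finally have eq: "?F * ?N * ?F * (?F * ?H) * N = ?F * (?N * ?H * N)" .
  have "left_factor n \<gamma> N * (?F * ?H) * N = \<gamma> \<cdot>\<^sub>m (?F * ?N * ?F * (?F * ?H) * N)"
    unfolding left_factor_def
    by (subst mult_smult_assoc_mat[of _ n n _ n], (intro m c)+,
        subst mult_smult_assoc_mat[of _ n n _ n], (intro m c N)+, rule refl)
  then show ?thesis by (simp only: eq)
qed

text \<open>The bound \<open>n \<ge> 2\<close> makes room for a minor of size two;
  \<open>n = 1\<close> is treated separately. The sort \<open>field_gcd\<close> supplies gcds of
  polynomials.\<close>

locale det_preserver =
  fixes n :: nat and T :: "'a :: {field_char_0, field_gcd} mat \<Rightarrow> 'a mat"
  assumes n: "n \<ge> 2"
    and linear: "toeplitz_linear n T"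
    and det_T: "\<And>A. A \<in> toeplitz_mats n \<Longrightarrow> det (T A) = det A"
begin

abbreviation N :: nat where "N \<equiv> 2 * n - 2"

text \<open>The map \<open>T\<close> transported to moment sequences. Entries beyond
  \<open>N\<close> are junk values, hence the bounds \<open>k \<le> N\<close> below.\<close>

definition phi :: "(nat \<Rightarrow> 'a) \<Rightarrow> nat \<Rightarrow> 'a" where
  "phi h = toeplitz_seq n (T (F_mat n * hankel n h))"

lemma T_F_hankel: "T (F_mat n * hankel n h) = F_mat n * hankel n (phi h)"
  unfolding phi_def using linear F_mult_hankel_toeplitz[of n h]
  by (intro toeplitz_conv_hankel) (auto simp: toeplitz_linear_def)

lemma det_phi: "det (hankel n (phi h)) = det (hankel n h)"
  using det_T[OF F_mult_hankel_toeplitz[of n h]]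
  by (simp add: T_F_hankel det_mult[where n = n] det_F_mat_nonzero)

lemma phi_cong: "(\<And>k. k \<le> N \<Longrightarrow> g k = h k) \<Longrightarrow> phi g = phi h"
  using hankel_cong[of n g h] by (simp add: phi_def)

lemma phi_lincomb:
  assumes "k \<le> N"
  shows "phi (\<lambda>k. g k + t * h k) k = phi g k + t * phi h k"
proof -
  have "T (F_mat n * hankel n (\<lambda>k. g k + t * h k)) = F_mat n * hankel n (\<lambda>k. phi g k + t * phi h k)"
    using linear F_mult_hankel_toeplitz[of n g] F_mult_hankel_toeplitz[of n h]
      smult_toeplitz[OF F_mult_hankel_toeplitz[of n h], of t]
    by (simp add: F_mult_hankel_lincomb toeplitz_linear_def T_F_hankel)
  then show ?thesis
    unfolding phi_def[of "\<lambda>k. g k + t * h k"] using assms n by (simp add: toeplitz_seq_F_hankel)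
qed

lemma det_phi_lincomb:
  "det (hankel n (\<lambda>k. phi g k + t * phi h k)) = det (hankel n (\<lambda>k. g k + t * h k))"
  using det_phi[of "\<lambda>k. g k + t * h k"] hankel_cong[of n "phi (\<lambda>k. g k + t * h k)" "\<lambda>k. phi g k + t * phi h k"]
  by (simp add: phi_lincomb)

section \<open>The matrix of \<open>phi\<close> and its invertibility\<close>

definition coef :: "nat \<Rightarrow> nat \<Rightarrow> 'a" where
  "coef k i = phi (\<lambda>j. if j = i then 1 else 0) k"

lemma phi_expand:
  assumes "k \<le> N"
  shows "phi h k = (\<Sum>i\<le>N. coef k i * h i)"
proof -
  have zero: "phi (\<lambda>_. 0) k = 0"
    using phi_lincomb[OF assms, of "\<lambda>_. 0" 1 "\<lambda>_. 0"] by simp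
  have "phi (\<lambda>j. if j < m then h j else 0) k = (\<Sum>i<m. coef k i * h i)" for m
  proof (induction m)
    case (Suc m)
    have "(\<lambda>j. if j < Suc m then h j else 0) =
        (\<lambda>j. (if j < m then h j else 0) + h m * (if j = m then 1 else 0))"
      by (auto simp: less_Suc_eq)
    then show ?case
      using phi_lincomb[OF assms] Suc by (simp add: coef_def mult.commute)
  qed (simp add: zero)
  from this[of "Suc N"] show ?thesis
    using phi_cong[of h "\<lambda>j. if j < Suc N then h j else 0"] by (simp add: lessThan_Suc_atMost)
qed

text \<open>A kernel vector would be a direction that never changes the determinant, hence zero by
  \<open>det_hankel_nondegenerate\<close>. So the matrix of \<open>phi\<close> is invertible, and
  the adjugate provides preimages.\<close>

lemma phi_surj: "\<exists>h. \<forall>k\<le>N. phi h k = f k"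
proof -
  define X where "X = mat (Suc N) (Suc N) (\<lambda>(k, i). coef k i)"
  have X: "X \<in> carrier_mat (Suc N) (Suc N)" by (simp add: X_def)
  have phi_X: "phi (\<lambda>i. v $ i) k = (X *\<^sub>v v) $ k" if "v \<in> carrier_vec (Suc N)" "k \<le> N" for v k
    using that by (auto simp: phi_expand X_def scalar_prod_def atLeast0LessThan lessThan_Suc_atMost
        simp del: sum.atMost_Suc sum.lessThan_Suc)
  have "det X \<noteq> 0"
  proof
    assume "det X = 0"
    then obtain v where v: "v \<in> carrier_vec (Suc N)" "v \<noteq> 0\<^sub>v (Suc N)" "X *\<^sub>v v = 0\<^sub>v (Suc N)"
      using det_0_iff_vec_prod_zero[OF X] by blast
    have "phi (\<lambda>i. v $ i) k = 0" if "k \<le> N" for k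
      using phi_X[OF v(1) that] v(3) that by simp
    then have "hankel n (\<lambda>k. phi g k + t * phi (\<lambda>i. v $ i) k) = hankel n (phi g)" for g t
      by (intro hankel_cong) simp
    then have "det (hankel n (\<lambda>k. g k + t * v $ k)) = det (hankel n g)" for g t
      using det_phi_lincomb[of g t "\<lambda>i. v $ i"] det_phi[of g] by simp
    from det_hankel_nondegenerate[OF n this] have "v = 0\<^sub>v (Suc N)"
      using v(1) by (intro eq_vecI) (auto simp: less_Suc_eq_le)
    with v(2) show False by simp
  qed
  define v where "v = (1 / det X) \<cdot>\<^sub>v (adj_mat X *\<^sub>v vec (Suc N) f)"
  have v: "v \<in> carrier_vec (Suc N)"
    using adj_mat(1)[OF X] by (auto simp: v_def)
  have "X *\<^sub>v v = (1 / det X) \<cdot>\<^sub>v (X * adj_mat X *\<^sub>v vec (Suc N) f)"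
    unfolding v_def using X adj_mat(1)[OF X]
    by (subst mult_mat_vec[of _ "Suc N" "Suc N"]) (auto simp: assoc_mult_mat_vec[of _ "Suc N" "Suc N" _ "Suc N"])
  also have "\<dots> = vec (Suc N) f"
    using \<open>det X \<noteq> 0\<close> by (simp add: adj_mat(2)[OF X], intro eq_vecI) auto
  finally have "\<forall>k\<le>N. phi (\<lambda>i. v $ i) k = f k"
    using phi_X[OF v] by simp
  then show ?thesis by blast
qed

text \<open>The base points in \<open>affine_dir\<close> are arbitrary, and surjectivity is what
  writes each of them as an image.\<close>

lemma affine_dir_phi:
  assumes "affine_dir n h"
  shows "affine_dir n (phi h)"
  unfolding affine_dir_def
proof (intro allI)
  fix g t
  obtain f where f: "\<And>k. k \<le> N \<Longrightarrow> phi f k = g k"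
    using phi_surj[of g] by blast
  have eq: "det (hankel n (\<lambda>k. g k + t * phi h k)) = det (hankel n (\<lambda>k. f k + t * h k))" for t
    using hankel_cong[of n "\<lambda>k. phi f k + t * phi h k" "\<lambda>k. g k + t * phi h k"] f
      det_phi_lincomb[of f t h] by simp
  show "det (hankel n (\<lambda>k. g k + t * phi h k)) =
     det (hankel n g) + t * (det (hankel n (\<lambda>k. g k + phi h k)) - det (hankel n g))"
    using assms eq[of 0] eq[of 1] eq[of t] by (simp add: affine_dir_def)
qed

text \<open>Row \<open>k\<close> of the matrix of \<open>phi\<close>, read as a polynomial: its
  value at \<open>x\<close> is entry \<open>k\<close> of the image of the powers of
  \<open>x\<close>.\<close>

definition P :: "nat \<Rightarrow> 'a poly" where
  "P k = (\<Sum>i\<le>N. monom (coef k i) i)"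

lemma phi_mom: "k \<le> N \<Longrightarrow> phi h k = mom h (P k)"
  by (simp add: phi_expand P_def mom_sum mom_monom)

text \<open>The image of a geometric sequence is an affine direction. It is therefore geometric, or
  its entries 0 and 1 both vanish; the relation holds either way, at every \<open>x\<close>.\<close>

lemma P_cross:
  assumes "k < N"
  shows "P 0 * P (Suc k) = P 1 * P k"
proof -
  have "poly (P 0 * P (Suc k)) x = poly (P 1 * P k) x" for x
  proof -
    have poly_P: "poly (P k) x = phi (\<lambda>i. x ^ i) k" if "k \<le> N" for k
      using mom_power[of 1 x "P k"] phi_mom[OF that, of "\<lambda>i. x ^ i"] by simp
    have "affine_dir n (phi (\<lambda>i. x ^ i))"
      using n by (intro affine_dir_phi affine_dir_geometric[of n _ 1 x]) auto
    then have "phi (\<lambda>i. x ^ i) 0 * phi (\<lambda>i. x ^ i) (Suc k) = phi (\<lambda>i. x ^ i) 1 * phi (\<lambda>i. x ^ i) k"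
      using n
    proof (cases rule: affine_dir_cases)
      case 1
      then show ?thesis using n by simp
    next
      case (2 c e)
      then show ?thesis using n assms by simp
    qed
    then show ?thesis
      using assms n by (simp add: poly_P)
  qed
  then show ?thesis
    using poly_eq_poly_eq_iff by blast
qed

lemma P_0_nonzero: "P 0 \<noteq> 0"
  using phi_surj[of "\<lambda>_. 1"] phi_mom[of 0] by auto

text \<open>By surjectivity some functional vanishes on \<open>P 0\<close> and equals 1 on
  \<open>P 1\<close>.\<close>

lemma P_1_independent: "P 1 \<noteq> smult c (P 0)"
proof
  assume eq: "P 1 = smult c (P 0)"
  obtain h where "\<forall>k\<le>N. phi h k = (if k = 1 then 1 else 0)"
    using phi_surj[of "\<lambda>k. if k = 1 then 1 else 0"] by blast
  moreover have "1 \<le> N" using n by simp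
  ultimately have "mom h (P 0) = 0" "mom h (P 1) = 1"
    using phi_mom[of 0 h] phi_mom[of 1 h] by simp_all
  then show False using eq by (simp add: mom_smult)
qed

lemma canonical_form:
  obtains \<gamma> r M where "\<gamma> \<noteq> 0" "r \<noteq> 0" "canonical n r M"
    "\<And>A. A \<in> toeplitz_mats n \<Longrightarrow> T A = left_factor n \<gamma> M * A * M"
proof -
  have deg: "degree (P k) \<le> N" if "k \<le> N" for k
    unfolding P_def by (intro degree_sum_le) (auto intro: order.trans[OF degree_monom_le])
  have "1 \<le> N" using n by simp
  then obtain A B c where AB: "degree A \<le> 1" "degree B \<le> 1" "c \<noteq> 0"
    and P: "\<And>k. k \<le> N \<Longrightarrow> P k = smult c (A ^ (N - k) * B ^ k)"
    using proportional_polys[OF _ deg P_cross P_0_nonzero P_1_independent] by blast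
  have "A \<noteq> 0"
    using P[of 0] P_0_nonzero n by auto
  moreover have "B \<noteq> smult d A" for d
  proof
    assume "B = smult d A"
    moreover have "Suc (N - 1) = N"
      using \<open>1 \<le> N\<close> by linarith
    then have "A ^ (N - 1) * A = A ^ N"
      by (simp only: power_Suc2[symmetric])
    ultimately have "P 1 = smult d (P 0)"
      using P[of 0] P[of 1] n by (simp add: mult.commute)
    with P_1_independent show False by blast
  qed
  ultimately obtain a r A' B' where norm: "a \<noteq> 0" "r \<noteq> 0" "degree A' \<le> 1" "degree B' \<le> 1"
      "A = smult a A'" "B = smult a B'" "canonical n r (param_mat n A' B')"
    using linear_pair_normal_form[OF AB(1,2)] by blast
  \<comment> \<open>The products \<open>A^(N-k) * B^k\<close> are homogeneous of degree
    \<open>N\<close> in the pair, so the common scalar \<open>a\<close> comes out as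
    \<open>a ^ N\<close> for every \<open>k\<close>.\<close>
  define \<gamma> where "\<gamma> = c * a ^ N"
  have P': "P k = smult \<gamma> (A' ^ (N - k) * B' ^ k)" if "k \<le> N" for k
  proof -
    have "P k = smult (c * (a ^ (N - k) * a ^ k)) (A' ^ (N - k) * B' ^ k)"
      using P[OF that] by (simp only: norm(5,6) smult_power) (simp add: mult_ac)
    also have "a ^ (N - k) * a ^ k = a ^ N"
      using that by (simp only: power_add[symmetric] le_add_diff_inverse2)
    finally show ?thesis by (simp only: \<gamma>_def)
  qed
  show thesis
  proof (rule that[of \<gamma> r "param_mat n A' B'"])
    show "\<gamma> \<noteq> 0" using AB norm by (simp add: \<gamma>_def)
    fix X :: "'a mat" assume "X \<in> toeplitz_mats n"
    then obtain h where X: "X = F_mat n * hankel n h"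
      using toeplitz_conv_hankel by blast
    have "hankel n (phi h) = hankel n (\<lambda>k. \<gamma> * mom h (A' ^ (N - k) * B' ^ k))"
      by (intro hankel_cong) (simp add: phi_mom P' mom_smult)
    also have "\<dots> = \<gamma> \<cdot>\<^sub>m hankel n (\<lambda>k. mom h (A' ^ (N - k) * B' ^ k))"
      by (rule eq_matI) (auto simp: hankel_def)
    finally have "T X = \<gamma> \<cdot>\<^sub>m (F_mat n * hankel n (\<lambda>k. mom h (A' ^ (N - k) * B' ^ k)))"
      by (simp add: X T_F_hankel mult_smult_distrib[where n = n and nr = n and nc = n])
    then show "T X = left_factor n \<gamma> (param_mat n A' B') * X * param_mat n A' B'"
      using n norm canonical_carrier[OF norm(7)]
      by (simp add: X left_factor_mult_F_hankel hankel_param_mat)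
  qed (use norm in auto)
qed

end

section \<open>The equivalence over a general field, and its normalization\<close>

lemma det_preserver_iff:
  fixes T :: "'a :: {field_char_0, field_gcd} mat \<Rightarrow> 'a mat"
  assumes n: "n \<ge> 1" and lin: "toeplitz_linear n T"
  shows "(\<forall>A \<in> toeplitz_mats n. det (T A) = det A) \<longleftrightarrow>
    (\<exists>\<gamma> r M N. \<gamma> \<noteq> 0 \<and> r \<noteq> 0 \<and> (\<forall>A \<in> toeplitz_mats n. T A = M * A * N) \<and>
       M = left_factor n \<gamma> N \<and> canonical n r N \<and> det (M * N) = 1)"
proof
  have det_MAN: "det (M * A * N) = det (M * N) * det A"
    if "M = left_factor n \<gamma> N" "canonical n r N" "A \<in> toeplitz_mats n" for \<gamma> r M N and A :: "'a mat"
  proof -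
    have "N \<in> carrier_mat n n" "A \<in> carrier_mat n n" "M \<in> carrier_mat n n"
      using canonical_carrier[OF that(2)] toeplitz_mats_carrier[OF that(3)] left_factor_carrier that(1)
      by auto
    then show ?thesis
      by (simp add: det_mult[where n = n] mult_carrier_mat[where n = n])
  qed
  {
    assume "\<exists>\<gamma> r M N. \<gamma> \<noteq> 0 \<and> r \<noteq> 0 \<and> (\<forall>A \<in> toeplitz_mats n. T A = M * A * N) \<and>
       M = left_factor n \<gamma> N \<and> canonical n r N \<and> det (M * N) = 1"
    then show "\<forall>A \<in> toeplitz_mats n. det (T A) = det A"
      using det_MAN by (metis mult_1)
  }
  assume pres: "\<forall>A \<in> toeplitz_mats n. det (T A) = det A"
  have "\<exists>\<gamma> r N. \<gamma> \<noteq> 0 \<and> r \<noteq> 0 \<and> canonical n r N \<and>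
    (\<forall>A \<in> toeplitz_mats n. T A = left_factor n \<gamma> N * A * N)"
  proof (cases "n = 1")
    case False
    then interpret det_preserver n T
      using n lin pres by unfold_locales auto
    show ?thesis
      by (rule canonical_form) blast
  next
    \<comment> \<open>For \<open>n = 1\<close> the map is determined by its value at the identity,
      so it is itself the identity: form (1) with \<open>\<alpha> = 0\<close>, \<open>r = 1\<close>
      and \<open>\<gamma> = 1\<close>.\<close>
    case True
    have T1: "T (1\<^sub>m 1) \<in> carrier_mat 1 1"
      using lin one_mat_toeplitz[of 1] toeplitz_mats_carrier[of _ n] True
      by (auto simp: toeplitz_linear_def)
    have "det (T (1\<^sub>m 1)) = 1"
      using pres one_mat_toeplitz[of 1, where ?'a = 'a] True by simp
    then have T_one: "T (1\<^sub>m 1) = 1\<^sub>m 1"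
      using T1 by (intro eq_matI) (auto simp: det_single)
    have T_id: "T A = A" if "A \<in> toeplitz_mats 1" for A
    proof -
      have A: "A = (A $$ (0, 0)) \<cdot>\<^sub>m 1\<^sub>m 1"
        using toeplitz_mats_carrier[OF that] by (intro eq_matI) auto
      have "T ((A $$ (0, 0)) \<cdot>\<^sub>m 1\<^sub>m 1) = (A $$ (0, 0)) \<cdot>\<^sub>m 1\<^sub>m 1"
        using lin one_mat_toeplitz[of 1, where ?'a = 'a] True T_one by (simp add: toeplitz_linear_def)
      then show ?thesis using A by simp
    qed
    have one: "V_mat 1 0 * D_mat 1 1 = (1\<^sub>m 1 :: 'a mat)"
      unfolding V_mat_D_param by (rule eq_matI) (auto simp: param_mat_def poly_cols_def)
    have "left_factor 1 1 (1\<^sub>m 1) = (1\<^sub>m 1 :: 'a mat)"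
      by (simp add: left_factor_def F_mat_square right_mult_one_mat[of _ 1 1])
        (rule eq_matI, auto)
    then have "\<forall>A \<in> toeplitz_mats 1. T A = left_factor 1 1 (1\<^sub>m 1) * A * 1\<^sub>m 1"
      using T_id toeplitz_mats_carrier left_mult_one_mat right_mult_one_mat by metis
    moreover have "canonical 1 1 (1\<^sub>m 1 :: 'a mat)"
      unfolding canonical_def one[symmetric] by blast
    ultimately show ?thesis
      unfolding True by (intro exI[of _ 1] exI[of _ "1\<^sub>m 1"]) simp
  qed
  then obtain \<gamma> r N where N: "\<gamma> \<noteq> 0" "r \<noteq> 0" "canonical n r N"
    "\<forall>A \<in> toeplitz_mats n. T A = left_factor n \<gamma> N * A * N"
    by blast
  \<comment> \<open>Preservation at the identity matrix gives the determinant condition.\<close>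
  moreover have "det (left_factor n \<gamma> N * N) = 1"
    using det_MAN[OF refl N(3) one_mat_toeplitz] pres N(4) one_mat_toeplitz[of n, where ?'a = 'a]
    by (metis det_one mult_1_right)
  ultimately show "\<exists>\<gamma> r M N. \<gamma> \<noteq> 0 \<and> r \<noteq> 0 \<and> (\<forall>A \<in> toeplitz_mats n. T A = M * A * N) \<and>
       M = left_factor n \<gamma> N \<and> canonical n r N \<and> det (M * N) = 1"
    by blast
qed

text \<open>Only the square of \<open>det N\<close> enters, so the signs of the reversal disappear.
  Form (3) yields one condition on the whole product, not one on each factor.\<close>

lemma det_normalization:
  fixes \<gamma> r :: "'a :: field"
  shows "det (left_factor n \<gamma> (V_mat n \<alpha> * D_mat n r) * (V_mat n \<alpha> * D_mat n r)) =
      \<gamma> ^ n * r ^ (n * (n - 1))"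
    and "det (left_factor n \<gamma> (V_mat n \<alpha> * F_mat n * D_mat n r) * (V_mat n \<alpha> * F_mat n * D_mat n r)) =
      \<gamma> ^ n * r ^ (n * (n - 1))"
    and "det (left_factor n \<gamma> (W_mat n \<alpha> \<beta> * D_mat n r) * (W_mat n \<alpha> \<beta> * D_mat n r)) =
      \<gamma> ^ n * r ^ (n * (n - 1)) * (\<alpha> - \<beta>) ^ (n * (n - 1))"
proof -
  have c: "V_mat n \<alpha> \<in> carrier_mat n n" "W_mat n \<alpha> \<beta> \<in> carrier_mat n n"
    by (simp_all add: V_mat_poly_cols W_mat_poly_cols)
  note simps = det_left_factor_mult det_mult[where n = n] mult_carrier_mat[where n = n]
    power_mult_distrib det_V_mat det_D_mat_square det_F_mat_square det_W_mat_square c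
  show "det (left_factor n \<gamma> (V_mat n \<alpha> * D_mat n r) * (V_mat n \<alpha> * D_mat n r)) =
      \<gamma> ^ n * r ^ (n * (n - 1))"
    and "det (left_factor n \<gamma> (V_mat n \<alpha> * F_mat n * D_mat n r) * (V_mat n \<alpha> * F_mat n * D_mat n r)) =
      \<gamma> ^ n * r ^ (n * (n - 1))"
    and "det (left_factor n \<gamma> (W_mat n \<alpha> \<beta> * D_mat n r) * (W_mat n \<alpha> \<beta> * D_mat n r)) =
      \<gamma> ^ n * r ^ (n * (n - 1)) * (\<alpha> - \<beta>) ^ (n * (n - 1))"
    by (simp_all add: simps mult_ac)
qed

theorem theorem4p3:
  fixes n :: nat
  assumes "n \<ge> 1"
  shows
   "(\<forall>T :: real mat \<Rightarrow> real mat. toeplitz_linear n T \<longrightarrow>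
       ((\<forall>A \<in> toeplitz_mats n. det (T A) = det A) \<longleftrightarrow>
        (\<exists>\<gamma> r M N. \<gamma> \<noteq> 0 \<and> r \<noteq> 0 \<and>
           (\<forall>A \<in> toeplitz_mats n. T A = M * A * N) \<and>
           M = left_factor n \<gamma> N \<and>
           ((\<exists>\<alpha>. N = V_mat n \<alpha> * D_mat n r) \<or>
            (\<exists>\<alpha>. N = V_mat n \<alpha> * F_mat n * D_mat n r) \<or>
            (\<exists>\<alpha> \<beta>. \<alpha> \<noteq> \<beta> \<and> N = W_mat n \<alpha> \<beta> * D_mat n r)) \<and>
           det (M * N) = 1))) \<and>
    (\<forall>(\<gamma> :: real) r M N. \<gamma> \<noteq> 0 \<longrightarrow> r \<noteq> 0 \<longrightarrow> M = left_factor n \<gamma> N \<longrightarrow>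
       (\<forall>\<alpha>. N = V_mat n \<alpha> * D_mat n r \<longrightarrow>
          (det (M * N) = 1 \<longleftrightarrow> \<gamma> ^ n * r ^ (n * (n - 1)) = 1)) \<and>
       (\<forall>\<alpha>. N = V_mat n \<alpha> * F_mat n * D_mat n r \<longrightarrow>
          (det (M * N) = 1 \<longleftrightarrow> \<gamma> ^ n * r ^ (n * (n - 1)) = 1)) \<and>
       (\<forall>\<alpha> \<beta>. \<alpha> \<noteq> \<beta> \<longrightarrow> N = W_mat n \<alpha> \<beta> * D_mat n r \<longrightarrow>
          (det (M * N) = 1 \<longleftrightarrow>
             \<gamma> ^ n * r ^ (n * (n - 1)) * (\<alpha> - \<beta>) ^ (n * (n - 1)) = 1))) \<and>
    (\<forall>T :: complex mat \<Rightarrow> complex mat. toeplitz_linear n T \<longrightarrow>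
       ((\<forall>A \<in> toeplitz_mats n. det (T A) = det A) \<longleftrightarrow>
        (\<exists>\<gamma> r M N. \<gamma> \<noteq> 0 \<and> r \<noteq> 0 \<and>
           (\<forall>A \<in> toeplitz_mats n. T A = M * A * N) \<and>
           M = left_factor n \<gamma> N \<and>
           ((\<exists>\<alpha>. N = V_mat n \<alpha> * D_mat n r) \<or>
            (\<exists>\<alpha>. N = V_mat n \<alpha> * F_mat n * D_mat n r) \<or>
            (\<exists>\<alpha> \<beta>. \<alpha> \<noteq> \<beta> \<and> N = W_mat n \<alpha> \<beta> * D_mat n r)) \<and>
           det (M * N) = 1))) \<and>
    (\<forall>(\<gamma> :: complex) r M N. \<gamma> \<noteq> 0 \<longrightarrow> r \<noteq> 0 \<longrightarrow> M = left_factor n \<gamma> N \<longrightarrow>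
       (\<forall>\<alpha>. N = V_mat n \<alpha> * D_mat n r \<longrightarrow>
          (det (M * N) = 1 \<longleftrightarrow> \<gamma> ^ n * r ^ (n * (n - 1)) = 1)) \<and>
       (\<forall>\<alpha>. N = V_mat n \<alpha> * F_mat n * D_mat n r \<longrightarrow>
          (det (M * N) = 1 \<longleftrightarrow> \<gamma> ^ n * r ^ (n * (n - 1)) = 1)) \<and>
       (\<forall>\<alpha> \<beta>. \<alpha> \<noteq> \<beta> \<longrightarrow> N = W_mat n \<alpha> \<beta> * D_mat n r \<longrightarrow>
          (det (M * N) = 1 \<longleftrightarrow>
             \<gamma> ^ n * r ^ (n * (n - 1)) * (\<alpha> - \<beta>) ^ (n * (n - 1)) = 1)))"
proof -
  note iff = det_preserver_iff[OF assms, unfolded canonical_def]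
  show ?thesis
    by (intro conjI allI impI; (rule iff; assumption)?; (simp only: det_normalization)?)
qed

end
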